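(* Let $d\ge3$, $m\ge1$, $\omega\in\Omega_{d,m}$, let $G_\omega$ be the corresponding spinal group with spinal generating set $S$, and let $\xi,\eta\in X^{\mathbb{N}}$. Then $(\Gamma_\xi,\xi)$ and $(\Gamma_\eta,\eta)$ are isomorphic as rooted, undirected, unlabeled graphs if and only if $\xi\sim\eta$ (i.e. $\xi$ and $\eta$ are compatible).
   Context: Let $X=\{0,\dots,d-1\}$ with addition modulo $d$. $T_d$ is the $d$-ary rooted tree with vertex set $X^*$ (finite words); its boundary is $X^{\mathbb{N}}$ (infinite words), on which automorphisms of $T_d$ act via prefixes. Let $a(v_0v_1\dots)=(v_0+1)v_1\dots$ and $A=\langle a\rangle\cong\mathbb{Z}/d\mathbb{Z}$. Let $B=(\mathbb{Z}/d\mathbb{Z})^m$ and let $\operatorname{Epi}(B,A)$ be the set of surjective homomorphisms $B\to A$. $\Omega_{d,m}$ is the set of sequences $\omega=(\omega_n)_{n\ge0}$ in $\operatorname{Epi}(B,A)$ with $\bigcap_{j\ge i}\operatorname{Ker}(\omega_j)=1$ for all $i\ge0$. For $b\in B$, $b_\omega\in\operatorname{Aut}(T_d)$ sends a word of the form $(d-1)^r0v_{r+1}v_{r+2}\dots$ ($r\ge0$) to $(d-1)^r0\,\omega_r(b)(v_{r+1})\,v_{r+2}\dots$ and fixes all other words. The map $b\mapsto b_\omega$ is an injective homomorphism, and $B$ is identified with its image $B_\omega$. The spinal group is $G_\omega=\langle A,B_\omega\rangle$ and its spinal generating set is $S=(A\cup B_\omega)\setminus\{1\}$. The Schreier graph $\Gamma_\xi$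 has as vertex set the orbit $G_\omega\cdot\xi$ and a directed edge labeled $s$ from $y$ to $s(y)$ for all $y\in G_\omega\cdot\xi$, $s\in S$. $(\Gamma,v)$ denotes $\Gamma$ rooted at $v$. As undirected, unlabeled graph one forgets orientations and labels of edges but keeps loops and multiple edges; isomorphisms of rooted graphs preserve the root. For $n\ge0$ and $0\le r\le n-1$ set $Y_r=(X\setminus\{0\})^{n-r-1}(X\setminus\{0,d-1\})(d-1)^r$, and $Y_n=\{(d-1)^n\}$; these sets partition $(X\setminus\{0\})^n$ (they record the number $r$ of trailing letters $d-1$). Two points $\xi,\eta\in X^{\mathbb{N}}$ are compatible, denoted $\xi\sim\eta$, if they are of the form $\xi=w_00w_10\dots$, $\eta=\tilde w_00\tilde w_10\dots$, with $w_k,\tilde w_k\in(X\setminus\{0\})^*\sqcup(X\setminus\{0\})^{\mathbb{N}}$ and $|w_k|=|\tilde w_k|$ for every $k$ (if some $w_k$ is infinite it is the last block), and such that for every $k\ge0$ with $n=|w_k|<\infty$ the words $w_k$ and $\tilde w_k$ lie in the same set $Y_r$ of the partition of $(X\setminus\{0\})^{n}$. *)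

theory Defs
  imports
    "HOL-Algebra.Bij"
    "HOL-Algebra.Group_Action"
    "HOL-Algebra.Generated_Groups"
    "HOL-Algebra.Elementary_Groups"
    "HOL-Algebra.Product_Groups"
    "HOL-Library.Stream"
    "Graph_Theory.Digraph"
begin

section \<open>The rooted tree, its automorphisms and its boundary\<close>

definition letters :: "nat \<Rightarrow> nat set" where
  "letters d = {..<d}"

definition words :: "nat \<Rightarrow> nat list set" where
  "words d = lists (letters d)"

definition tree_adj :: "nat \<Rightarrow> nat list \<Rightarrow> nat list \<Rightarrow> bool" where
  "tree_adj d u v \<longleftrightarrow> (\<exists>x\<in>letters d. v = u @ [x] \<or> u = v @ [x])"

text \<open>Automorphisms are represented, as in \<^const>\<open>BijGroup\<close>, by functions that are
  undefined outside the vertex set; the group operation is composition, acting on the left.\<close>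

definition aut_tree :: "nat \<Rightarrow> (nat list \<Rightarrow> nat list) monoid" where
  "aut_tree d = BijGroup (words d)
     \<lparr>carrier := {g \<in> Bij (words d). g [] = [] \<and>
        (\<forall>u\<in>words d. \<forall>v\<in>words d. tree_adj d (g u) (g v) \<longleftrightarrow> tree_adj d u v)}\<rparr>"

definition boundary :: "nat \<Rightarrow> nat stream set" where
  "boundary d = streams (letters d)"

definition bdry_act :: "(nat list \<Rightarrow> nat list) \<Rightarrow> nat stream \<Rightarrow> nat stream" where
  "bdry_act g \<xi> = (THE \<zeta>. \<forall>n. stake n \<zeta> = g (stake n \<xi>))"


section \<open>Spinal groups\<close>

definition rot :: "nat \<Rightarrow> nat list \<Rightarrow> nat list" where
  "rot d = (\<lambda>w\<in>words d. case w of [] \<Rightarrow> [] | v # w' \<Rightarrow> ((v + 1) mod d) # w')"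

definition A_group :: "nat \<Rightarrow> (nat list \<Rightarrow> nat list) monoid" where
  "A_group d = subgroup_generated (aut_tree d) {rot d}"

definition B_group :: "nat \<Rightarrow> nat \<Rightarrow> (nat \<Rightarrow> int) monoid" where
  "B_group d m = product_group {..<m} (\<lambda>_. integer_mod_group d)"

type_synonym spinal_seq = "nat \<Rightarrow> (nat \<Rightarrow> int) \<Rightarrow> nat list \<Rightarrow> nat list"

definition Omega :: "nat \<Rightarrow> nat \<Rightarrow> spinal_seq set" where
  "Omega d m = {\<omega>.
     (\<forall>n. \<omega> n \<in> epi (B_group d m) (A_group d)) \<and>
     (\<forall>i. (\<Inter>j\<in>{i..}. kernel (B_group d m) (A_group d) (\<omega> j)) = {\<one>\<^bsub>B_group d m\<^esub>})}"

text \<open>In \<open>spine d \<omega> b w\<close>, the number \<open>r\<close> of leading letters \<open>d - 1\<close> of \<open>w\<close> is the only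
  exponent for which \<open>w\<close> can have the form \<open>(d-1)\<^sup>r 0 u\<close>. As an element of \<^term>\<open>A_group d\<close>,
  \<open>\<omega> r b\<close> changes only the first letter of \<open>u\<close>, so it is applied to the whole suffix \<open>u\<close>.\<close>

definition spine :: "nat \<Rightarrow> spinal_seq \<Rightarrow> (nat \<Rightarrow> int) \<Rightarrow> nat list \<Rightarrow> nat list" where
  "spine d \<omega> b = (\<lambda>w\<in>words d.
     let r = length (takeWhile (\<lambda>x. x = d - 1) w) in
     if r < length w \<and> w ! r = 0
     then replicate r (d - 1) @ 0 # \<omega> r b (drop (Suc r) w)
     else w)"

definition B_image :: "nat \<Rightarrow> nat \<Rightarrow> spinal_seq \<Rightarrow> (nat list \<Rightarrow> nat list) set" where
  "B_image d m \<omega> = spine d \<omega> ` carrier (B_group d m)"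

definition spinal_group :: "nat \<Rightarrow> nat \<Rightarrow> spinal_seq \<Rightarrow> (nat list \<Rightarrow> nat list) monoid" where
  "spinal_group d m \<omega> = subgroup_generated (aut_tree d) (carrier (A_group d) \<union> B_image d m \<omega>)"

definition spinal_gens :: "nat \<Rightarrow> nat \<Rightarrow> spinal_seq \<Rightarrow> (nat list \<Rightarrow> nat list) set" where
  "spinal_gens d m \<omega> = (carrier (A_group d) \<union> B_image d m \<omega>) - {\<one>\<^bsub>aut_tree d\<^esub>}"


section \<open>Schreier graphs\<close>

text \<open>The arc \<open>(y, s)\<close> is the edge labeled \<open>s\<close> from \<open>y\<close> to \<open>s(y)\<close>.\<close>

definition schreier_graph ::
  "nat \<Rightarrow> nat \<Rightarrow> spinal_seq \<Rightarrow> nat stream \<Rightarrow>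
    (nat stream, nat stream \<times> (nat list \<Rightarrow> nat list)) pre_digraph" where
  "schreier_graph d m \<omega> \<xi> =
     \<lparr>verts = orbit (spinal_group d m \<omega>) bdry_act \<xi>,
      arcs = orbit (spinal_group d m \<omega>) bdry_act \<xi> \<times> spinal_gens d m \<omega>,
      tail = (\<lambda>(y, s). y),
      head = (\<lambda>(y, s). bdry_act s y)\<rparr>"

text \<open>Isomorphism of the underlying rooted undirected multigraphs: every arc counts as one
  undirected edge, whose unordered pair of endpoints (a singleton for a loop) has to be
  preserved by the bijection between the edges.\<close>

definition rooted_undirected_iso ::
  "('v, 'e) pre_digraph \<Rightarrow> 'v \<Rightarrow> ('w, 'f) pre_digraph \<Rightarrow> 'w \<Rightarrow> bool" where
  "rooted_undirected_iso G x H y \<longleftrightarrow>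
     (\<exists>\<phi> \<psi>. bij_betw \<phi> (verts G) (verts H) \<and> bij_betw \<psi> (arcs G) (arcs H) \<and>
        (\<forall>e\<in>arcs G. {tail H (\<psi> e), head H (\<psi> e)} = \<phi> ` {tail G e, head G e}) \<and>
        \<phi> x = y)"


section \<open>Compatible boundary points\<close>

text \<open>\<open>Y_block d n r\<close> is the set \<open>Y\<^sub>r\<close> of the partition of \<open>(X - {0})\<^sup>n\<close>; it is only
  meant for \<open>r \<le> n\<close>.\<close>

definition Y_block :: "nat \<Rightarrow> nat \<Rightarrow> nat \<Rightarrow> nat list set" where
  "Y_block d n r =
     (if r < n
      then {u @ [x] @ replicate r (d - 1) | u x.
              u \<in> lists (letters d - {0}) \<and> length u = n - r - 1 \<and> x \<in> letters d - {0, d - 1}}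
      else {replicate n (d - 1)})"

definition compat_block :: "nat \<Rightarrow> nat list \<Rightarrow> nat list \<Rightarrow> bool" where
  "compat_block d w w' \<longleftrightarrow>
     w \<in> lists (letters d - {0}) \<and> w' \<in> lists (letters d - {0}) \<and> length w = length w' \<and>
     (\<exists>r\<le>length w. w \<in> Y_block d (length w) r \<and> w' \<in> Y_block d (length w) r)"

text \<open>The first disjunct is the case that all blocks are finite, the second one the case
  that there is a last, infinite block.\<close>

definition compatible :: "nat \<Rightarrow> nat stream \<Rightarrow> nat stream \<Rightarrow> bool" where
  "compatible d \<xi> \<eta> \<longleftrightarrow>
     (\<exists>ws ws'. stream_all2 (compat_block d) ws ws' \<and>
        \<xi> = flat (smap (\<lambda>w. w @ [0]) ws) \<and>
        \<eta> = flat (smap (\<lambda>w. w @ [0]) ws')) \<or>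
     (\<exists>ws ws' t t'. list_all2 (compat_block d) ws ws' \<and>
        t \<in> streams (letters d - {0}) \<and> t' \<in> streams (letters d - {0}) \<and>
        \<xi> = concat (map (\<lambda>w. w @ [0]) ws) @- t \<and>
        \<eta> = concat (map (\<lambda>w. w @ [0]) ws') @- t')"

end

theory Submission
  imports Defs
begin

text \<open>In \<open>\<Gamma>\<^sub>\<xi>\<close> every vertex lies in a clique of points differing in the first letter, and each
  point \<open>(d-1)\<^sup>r 0 v t\<close> also in a clique of the points \<open>(d-1)\<^sup>r 0 x t\<close>; all other points carry only
  further loops, and more of them. Since \<open>d \<ge> 3\<close>, a clique of the first kind contains a point with the
  maximal number of loops and a clique of the second kind does not, so the graph determines both
  kinds of cliques. By induction on \<open>n\<close> it then determines which vertices agree from the \<open>n\<close>th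
  letter on, and which begin with \<open>(d-1)\<^sup>n 0\<close>. Seen from the root \<open>\<xi>\<close> this tells for all \<open>n\<close> and
  \<open>k\<close> whether \<open>\<xi>\<close> has \<open>(d-1)\<^sup>k 0\<close> at position \<open>n\<close>, which is exactly the compatibility class of \<open>\<xi>\<close>.

  Conversely, for compatible \<open>\<xi>\<close> and \<open>\<eta>\<close> the map exchanging the letters \<open>\<xi>\<^sub>n\<close> and \<open>\<eta>\<^sub>n\<close> at
  position \<open>n\<close> of those points which agree with \<open>\<xi>\<close> after \<open>n\<close> respects all cliques and all the
  exponents \<open>r\<close>, hence also the multiplicities of edges and loops.\<close>

section \<open>Compatibility by positions\<close>

text \<open>The obstacle is that an unlabeled edge hides both its kind and its exponent r. Between
  two distinct points of a spine clique run |Ker \<omega>_r| = d^(m-1) edges in each direction,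
  whatever r is, so multiplicities never reveal r; for m = 1 this is 1, just as in a rotation
  clique. Loops therefore serve only to detect whether some r exists, and r itself is found from the
  coarse structure. Call the points with the same letters from position n on a cluster of level n.
  The spine cliques of exponent n are those that glue d clusters of level n + 1 into one of level n
  + 2. In the converse direction, exchanging letters at position n in all points would destroy
  patterns (d-1)^r 0 of points unrelated to \<xi>. Where the rest of the point agrees with \<xi>,
  the patterns of \<xi> and \<eta> control what the exchange can do, and nothing is
  destroyed.\<close>

definition lead :: "nat \<Rightarrow> nat \<Rightarrow> nat stream \<Rightarrow> bool" where
  "lead d r \<zeta> \<longleftrightarrow> \<zeta> !! r = 0 \<and> (\<forall>i<r. \<zeta> !! i = d - 1)"

text \<open>The invariant through which both directions pass: it speaks of positions instead of
  blocks, and so can be compared with the graph as well as with the block form.\<close>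

definition same_leads :: "nat \<Rightarrow> nat stream \<Rightarrow> nat stream \<Rightarrow> bool" where
  "same_leads d \<xi> \<eta> \<longleftrightarrow> (\<forall>n k. lead d k (sdrop n \<xi>) \<longleftrightarrow> lead d k (sdrop n \<eta>))"

lemma lead_sdrop: "lead d r (sdrop n \<zeta>) \<longleftrightarrow> \<zeta> !! (n + r) = 0 \<and> (\<forall>i<r. \<zeta> !! (n + i) = d - 1)"
  by (simp add: lead_def sdrop_snth)

lemma stream_eq_iff_snth: "s = t \<longleftrightarrow> (\<forall>n. s !! n = t !! n)"
  using smap_alt[of "\<lambda>x. x" s t] by (simp add: stream.map_ident)

lemma sdrop_eq_iff_snth: "sdrop n s = sdrop n t \<longleftrightarrow> (\<forall>i\<ge>n. s !! i = t !! i)"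
  unfolding stream_eq_iff_snth sdrop_snth by (metis le_add1 nat_le_iff_add)

lemma sdrop_eq_mono: "sdrop n s = sdrop n t \<Longrightarrow> n \<le> k \<Longrightarrow> sdrop k s = sdrop k t"
  by (auto simp: sdrop_eq_iff_snth)

section \<open>Trailing runs of d - 1 and the sets Y_r\<close>

definition all_max :: "nat \<Rightarrow> nat \<Rightarrow> nat list \<Rightarrow> bool" where
  "all_max d n w \<longleftrightarrow> (\<forall>i<length w. n \<le> i \<longrightarrow> w ! i = d - 1)"

text \<open>Membership in Y_r fixes the length of the trailing run of letters d - 1. As
  \<open>all_max\<close> is vacuous from \<open>length w\<close> on, its threshold is the start of
  that run.\<close>

lemma Y_block_iff_all_max:
  assumes "w \<in> lists (letters d - {0})" "r \<le> length w" "d \<ge> 2"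
  shows "w \<in> Y_block d (length w) r \<longleftrightarrow> (\<forall>n. all_max d n w \<longleftrightarrow> length w - r \<le> n)"
proof (cases "r = length w")
  case True
  have "w = replicate (length w) (d - 1) \<longleftrightarrow> (\<forall>i<length w. w ! i = d - 1)"
    by (auto simp: list_eq_iff_nth_eq)
  then show ?thesis using True by (auto simp: Y_block_def all_max_def)
next
  case False
  with assms have r: "r < length w" by simp
  \<comment> \<open>The place of the letter x that stops the trailing run.\<close>
  let ?j = "length w - r - 1"
  have "w \<in> Y_block d (length w) r \<longleftrightarrow> (\<forall>i<length w. ?j < i \<longrightarrow> w ! i = d - 1) \<and> w ! ?j \<noteq> d - 1"
    (is "?L \<longleftrightarrow> ?R")
  proof
    assume ?L
    then obtain u x where w: "w = u @ [x] @ replicate r (d - 1)" "length u = ?j" "x \<noteq> d - 1"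
      using r by (auto simp: Y_block_def)
    show ?R
    proof (intro conjI allI impI)
      show "w ! ?j \<noteq> d - 1" using w by (metis append_Cons nth_append_length)
      fix i assume i: "i < length w" "?j < i"
      have "w ! i = (u @ [x] @ replicate r (d - 1)) ! i" using w(1) by simp
      also have "\<dots> = d - 1" using i w(2) r by (auto simp: nth_append nth_Cons' )
      finally show "w ! i = d - 1" .
    qed
  next
    assume R: ?R
    have "w = take ?j w @ w ! ?j # drop (Suc ?j) w"
      using r by (intro id_take_nth_drop) simp
    moreover have "drop (Suc ?j) w = replicate r (d - 1)"
      using R r by (auto simp: list_eq_iff_nth_eq)
    moreover have "take ?j w \<in> lists (letters d - {0})" "w ! ?j \<in> letters d - {0}"
      using assms r by (auto dest: in_set_takeD)
    ultimately show ?L using R r unfolding Y_block_def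
      by (auto intro!: exI[of _ "take ?j w"] exI[of _ "w ! ?j"])
  qed
  also have "\<dots> \<longleftrightarrow> (\<forall>n. all_max d n w \<longleftrightarrow> length w - r \<le> n)" (is "?R \<longleftrightarrow> ?A")
  proof
    assume R: ?R
    show ?A
    proof (intro allI iffI)
      fix n assume "all_max d n w"
      show "length w - r \<le> n"
      proof (rule ccontr)
        assume "\<not> length w - r \<le> n"
        then have "n \<le> ?j" "?j < length w" using r by auto
        then show False using R \<open>all_max d n w\<close> unfolding all_max_def by blast
      qed
    next
      fix n assume "length w - r \<le> n" then show "all_max d n w" using R r unfolding all_max_def by auto
    qed
  next
    assume A: ?A
    have "all_max d (length w - r) w" "\<not> all_max d ?j w" using A r by auto
    moreover have "i = ?j" if "\<not> length w - r \<le> i" "?j \<le> i" for i using that by linarith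
    ultimately show ?R unfolding all_max_def
      by (metis Suc_leI Suc_diff_Suc diff_diff_left r add.commute plus_1_eq_Suc zero_less_diff)
  qed
  finally show ?thesis .
qed

text \<open>The predicate is upward closed in n and true at \<open>length w\<close>, so its least
  solution describes it completely.\<close>

lemma all_max_threshold: "\<exists>r\<le>length w. \<forall>n. all_max d n w \<longleftrightarrow> length w - r \<le> n"
proof -
  have L: "all_max d (length w) w" by (simp add: all_max_def)
  define m where "m = (LEAST n. all_max d n w)"
  have m: "all_max d m w" "\<And>n. all_max d n w \<Longrightarrow> m \<le> n"
    unfolding m_def using L by (auto intro: LeastI[of "\<lambda>n. all_max d n w"] Least_le[of "\<lambda>n. all_max d n w"])
  have "all_max d n w \<longleftrightarrow> m \<le> n" for n
  proof
    assume "m \<le> n"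
    then show "all_max d n w" using m(1) unfolding all_max_def by auto
  qed (rule m(2))
  then show ?thesis using m(2)[OF L] by (intro exI[of _ "length w - m"]) auto
qed

text \<open>The threshold determines r, so the existential over r turns into a comparison position
  by position, which is the shape of \<open>same_leads\<close>.\<close>

lemma compat_block_iff:
  assumes "d \<ge> 2"
  shows "compat_block d w w' \<longleftrightarrow> w \<in> lists (letters d - {0}) \<and> w' \<in> lists (letters d - {0}) \<and>
    length w = length w' \<and> (\<forall>n. all_max d n w \<longleftrightarrow> all_max d n w')"
proof -
  have "(\<exists>r\<le>length w. w \<in> Y_block d (length w) r \<and> w' \<in> Y_block d (length w) r) \<longleftrightarrow>
      (\<forall>n. all_max d n w \<longleftrightarrow> all_max d n w')"
    if w: "w \<in> lists (letters d - {0})" and w': "w' \<in> lists (letters d - {0})" and l: "length w = length w'"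
  proof -
    note Y = Y_block_iff_all_max[OF w _ assms] Y_block_iff_all_max[OF w' _ assms, folded l]
    obtain r where r: "r \<le> length w" "\<forall>n. all_max d n w \<longleftrightarrow> length w - r \<le> n"
      using all_max_threshold by blast
    show ?thesis
    proof
      assume "\<forall>n. all_max d n w \<longleftrightarrow> all_max d n w'"
      then show "\<exists>r\<le>length w. w \<in> Y_block d (length w) r \<and> w' \<in> Y_block d (length w) r"
        using r Y by (intro exI[of _ r]) simp
    next
      assume "\<exists>r\<le>length w. w \<in> Y_block d (length w) r \<and> w' \<in> Y_block d (length w) r"
      then show "\<forall>n. all_max d n w \<longleftrightarrow> all_max d n w'" using Y by auto
    qed
  qed
  then show ?thesis unfolding compat_block_def by blast
qed

abbreviation zero_ended :: "nat list \<Rightarrow> nat list" where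
  "zero_ended w \<equiv> w @ [0]"

text \<open>Peels off one block in both forms of compatibility at once, so that the induction over
  positions need not tell finite from infinite sequences of blocks.\<close>

lemma compatible_cases:
  assumes "compatible d \<xi> \<eta>"
  obtains (block) w w' \<xi>' \<eta>' where "compat_block d w w'" "compatible d \<xi>' \<eta>'"
      "\<xi> = zero_ended w @- \<xi>'" "\<eta> = zero_ended w' @- \<eta>'"
    | (tail) "\<xi> \<in> streams (letters d - {0})" "\<eta> \<in> streams (letters d - {0})"
  using assms unfolding compatible_def
proof (elim disjE exE conjE)
  fix ws ws'
  assume all: "stream_all2 (compat_block d) ws ws'"
    and eq: "\<xi> = flat (smap zero_ended ws)" "\<eta> = flat (smap zero_ended ws')"
  obtain w v w' v' where ws: "ws = w ## v" "ws' = w' ## v'"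
    by (metis stream.exhaust)
  then have ws_all: "compat_block d w w'" "stream_all2 (compat_block d) v v'"
    using all by simp_all
  show thesis
  proof (rule block[OF ws_all(1)])
    show "compatible d (flat (smap zero_ended v)) (flat (smap zero_ended v'))"
      unfolding compatible_def
      by (intro disjI1 exI[of _ v] exI[of _ v'] conjI refl ws_all(2))
    show "\<xi> = zero_ended w @- flat (smap zero_ended v)" unfolding eq(1) ws(1) by simp
    show "\<eta> = zero_ended w' @- flat (smap zero_ended v')" unfolding eq(2) ws(2) by simp
  qed
next
  fix ws ws' t t'
  assume a: "list_all2 (compat_block d) ws ws'"
     "t \<in> streams (letters d - {0})" "t' \<in> streams (letters d - {0})"
     "\<xi> = concat (map zero_ended ws) @- t" "\<eta> = concat (map zero_ended ws') @- t'"
  show thesis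
  proof (cases ws)
    case Nil
    then show thesis using a tail by simp
  next
    case (Cons w v)
    then obtain w' v' where v: "ws' = w' # v'" "compat_block d w w'" "list_all2 (compat_block d) v v'"
      using a(1) by (cases ws') auto
    show thesis
    proof (rule block[OF v(2)])
      show "compatible d (concat (map zero_ended v) @- t) (concat (map zero_ended v') @- t')"
        unfolding compatible_def
        by (intro disjI2 exI[of _ v] exI[of _ v'] exI[of _ t] exI[of _ t'] conjI refl v(3) a(2,3))
      show "\<xi> = zero_ended w @- (concat (map zero_ended v) @- t)" unfolding a(4) Cons by simp
      show "\<eta> = zero_ended w' @- (concat (map zero_ended v') @- t')" unfolding a(5) v(1) by simp
    qed
  qed
qed

text \<open>The letters of \<open>w\<close> are nonzero and d - 1 is not 0, so a run starting inside
  the block can stop only at the zero that ends it; this forces k.\<close>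

lemma lead_sdrop_block:
  assumes "w \<in> lists (letters d - {0})" "n \<le> length w" "d \<ge> 2"
  shows "lead d k (sdrop n (zero_ended w @- s)) \<longleftrightarrow> n + k = length w \<and> all_max d n w"
proof -
  have z: "(zero_ended w @- s) !! i = (if i < length w then w ! i else 0)" if "i \<le> length w" for i
    using that by (auto simp: shift_snth simp del: shift_append shift.simps) (simp_all add: nth_append)
  have nz: "w ! i \<noteq> 0" if "i < length w" for i
    using assms that by (auto simp: lists_eq_set letters_def dest: nth_mem)
  show ?thesis
  proof
    assume "lead d k (sdrop n (zero_ended w @- s))"
    then have L: "(zero_ended w @- s) !! (n + k) = 0"
        "\<And>i. i < k \<Longrightarrow> (zero_ended w @- s) !! (n + i) = d - 1"
      unfolding lead_sdrop by blast+
    have 1: "\<not> n + k < length w"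
    proof
      assume "n + k < length w"
      then show False using z[of "n + k"] nz[of "n + k"] L(1) by auto
    qed
    have 2: "\<not> length w < n + k"
    proof
      assume "length w < n + k"
      then have "(zero_ended w @- s) !! (n + (length w - n)) = d - 1"
        using assms(2) by (intro L(2)) linarith
      then show False using z[of "length w"] assms(2,3) by simp
    qed
    have nk: "n + k = length w" using 1 2 by linarith
    show "n + k = length w \<and> all_max d n w"
      unfolding all_max_def
    proof (intro conjI allI impI nk)
      fix i assume i: "i < length w" "n \<le> i"
      then have "(zero_ended w @- s) !! (n + (i - n)) = d - 1" using nk by (intro L(2)) linarith
      then show "w ! i = d - 1" using z[of i] i by simp
    qed
  next
    assume "n + k = length w \<and> all_max d n w"
    then show "lead d k (sdrop n (zero_ended w @- s))"
      unfolding lead_sdrop using z by (auto simp: all_max_def)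
  qed
qed

lemma same_leads_if_compatible:
  assumes "d \<ge> 2" "compatible d \<xi> \<eta>"
  shows "same_leads d \<xi> \<eta>"
proof -
  have "lead d k (sdrop n \<xi>) \<longleftrightarrow> lead d k (sdrop n \<eta>)" if "compatible d \<xi> \<eta>" for n k \<xi> \<eta>
    using that
  \<comment> \<open>Beyond the first block, the same place in the remaining stream has an index
    smaller by \<open>Suc (length w)\<close>.\<close>
  proof (induction n arbitrary: \<xi> \<eta> rule: less_induct)
    case (less n)
    from less.prems show ?case
    proof (cases rule: compatible_cases)
      case (block w w' \<xi>' \<eta>')
      have w: "w \<in> lists (letters d - {0})" "w' \<in> lists (letters d - {0})" "length w = length w'"
          "\<And>n. all_max d n w \<longleftrightarrow> all_max d n w'"
        using block(1) compat_block_iff[OF assms(1)] by blast+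
      show ?thesis
      proof (cases "n \<le> length w")
        case True
        then show ?thesis
          using lead_sdrop_block[OF w(1) True assms(1)] lead_sdrop_block[OF w(2) _ assms(1), of n] w(3,4)
          unfolding block(3,4) by simp
      next
        case False
        have "sdrop n (zero_ended u @- s) = sdrop (n - Suc (length w)) s" if "length u = length w" for u s
          using False that by (subst sdrop_shift) simp
        then have "sdrop n \<xi> = sdrop (n - Suc (length w)) \<xi>'" "sdrop n \<eta> = sdrop (n - Suc (length w)) \<eta>'"
          unfolding block(3,4) using w(3) by simp_all
        then show ?thesis using less.IH[OF _ block(2)] False by simp
      qed
    next
      case tail
      then have "\<xi> !! i \<noteq> 0" "\<eta> !! i \<noteq> 0" for i by (auto simp: streams_iff_snth)
      then show ?thesis unfolding lead_sdrop by blast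
    qed
  qed
  then show ?thesis using assms(2) by (simp add: same_leads_def)
qed

lemma same_leads_sdrop: "same_leads d \<xi> \<eta> \<Longrightarrow> same_leads d (sdrop n \<xi>) (sdrop n \<eta>)"
  unfolding same_leads_def sdrop_add by blast

lemma same_leads_zero:
  assumes "same_leads d \<xi> \<eta>"
  shows "\<xi> !! n = 0 \<longleftrightarrow> \<eta> !! n = 0"
proof -
  have "lead d 0 (sdrop n \<xi>) \<longleftrightarrow> lead d 0 (sdrop n \<eta>)" using assms unfolding same_leads_def by blast
  then show ?thesis by (simp add: lead_sdrop)
qed

lemma same_leads_sym: "same_leads d \<xi> \<eta> \<Longrightarrow> same_leads d \<eta> \<xi>"
  unfolding same_leads_def by blast

section \<open>Cutting a stream into blocks at its zeros\<close>

definition zero_pos :: "nat stream \<Rightarrow> nat" where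
  "zero_pos \<xi> = (LEAST n. \<xi> !! n = 0)"

lemma zero_pos:
  assumes "\<xi> !! n = 0"
  shows "\<xi> !! zero_pos \<xi> = 0" "\<And>i. i < zero_pos \<xi> \<Longrightarrow> \<xi> !! i \<noteq> 0"
  using LeastI[of "\<lambda>n. \<xi> !! n = 0", OF assms] not_less_Least[of _ "\<lambda>n. \<xi> !! n = 0"]
  unfolding zero_pos_def by blast+

definition after_zero :: "nat stream \<Rightarrow> nat stream" where
  "after_zero \<xi> = sdrop (Suc (zero_pos \<xi>)) \<xi>"

lemma block_decomp:
  assumes "\<xi> !! n = 0"
  shows "\<xi> = zero_ended (stake (zero_pos \<xi>) \<xi>) @- after_zero \<xi>"
  using id_stake_snth_sdrop[of \<xi> "zero_pos \<xi>"] zero_pos(1)[OF assms] by (simp add: after_zero_def)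

text \<open>The predicates under \<open>LEAST\<close> coincide, so the values agree even for streams
  without zeros, where \<open>LEAST\<close> is unspecified.\<close>

lemma same_leads_zero_pos: "same_leads d \<xi> \<eta> \<Longrightarrow> zero_pos \<xi> = zero_pos \<eta>"
  unfolding zero_pos_def using same_leads_zero[of d \<xi> \<eta>] by presburger

lemma same_leads_after_zero:
  "same_leads d \<xi> \<eta> \<Longrightarrow> same_leads d (after_zero \<xi>) (after_zero \<eta>)"
  unfolding after_zero_def using same_leads_zero_pos[of d \<xi> \<eta>] same_leads_sdrop[of d \<xi> \<eta>] by presburger

lemma stake_zero_pos_in_lists:
  assumes "\<xi> \<in> boundary d" "\<xi> !! n = 0"
  shows "stake (zero_pos \<xi>) \<xi> \<in> lists (letters d - {0})"
  using assms zero_pos(2)[OF assms(2)]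
  by (auto simp: in_set_conv_nth boundary_def streams_iff_snth simp del: neq0_conv)

lemma boundary_sdrop: "\<xi> \<in> boundary d \<Longrightarrow> sdrop n \<xi> \<in> boundary d"
  by (simp add: boundary_def streams_iff_snth sdrop_snth)

text \<open>A lead at position k that reaches the first zero says that the block consists of letters
  d - 1 from k on; past the block \<open>all_max\<close> is vacuous on both sides.\<close>

lemma compat_block_first:
  assumes "d \<ge> 2" "\<xi> \<in> boundary d" "\<eta> \<in> boundary d" "same_leads d \<xi> \<eta>" "\<xi> !! n = 0"
  shows "compat_block d (stake (zero_pos \<xi>) \<xi>) (stake (zero_pos \<eta>) \<eta>)"
proof -
  have z: "\<eta> !! n = 0" using assms(4,5) same_leads_zero by blast
  note l = stake_zero_pos_in_lists[OF assms(2,5)] stake_zero_pos_in_lists[OF assms(3) z]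
  have p: "zero_pos \<xi> = zero_pos \<eta>" using assms(4) by (rule same_leads_zero_pos)
  have "all_max d k (stake (zero_pos \<xi>) \<xi>) \<longleftrightarrow> all_max d k (stake (zero_pos \<eta>) \<eta>)" for k
  proof (cases "k \<le> zero_pos \<xi>")
    case True
    then have "lead d (zero_pos \<xi> - k) (sdrop k \<xi>) \<longleftrightarrow> all_max d k (stake (zero_pos \<xi>) \<xi>)"
       "lead d (zero_pos \<xi> - k) (sdrop k \<eta>) \<longleftrightarrow> all_max d k (stake (zero_pos \<eta>) \<eta>)"
      using lead_sdrop_block[OF l(1) _ assms(1), of k "zero_pos \<xi> - k" "after_zero \<xi>", folded block_decomp[OF assms(5)]]
        lead_sdrop_block[OF l(2) _ assms(1), of k "zero_pos \<xi> - k" "after_zero \<eta>", folded block_decomp[OF z]] p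
      by simp_all
    then show ?thesis using assms(4) unfolding same_leads_def by blast
  next
    case False
    then show ?thesis using p by (simp add: all_max_def)
  qed
  then show ?thesis using l p by (simp add: compat_block_iff[OF assms(1)])
qed

lemma stream_all2_iff_snth: "stream_all2 P s t \<longleftrightarrow> (\<forall>n. P (s !! n) (t !! n))"
proof
  assume "stream_all2 P s t"
  have "P (s !! n) (t !! n)" for n
    using \<open>stream_all2 P s t\<close>
  proof (induction n arbitrary: s t)
    case 0
    then show ?case by (cases s; cases t) simp
  next
    case (Suc n)
    then show ?case by (cases s; cases t) simp
  qed
  then show "\<forall>n. P (s !! n) (t !! n)" by blast
next
  assume "\<forall>n. P (s !! n) (t !! n)"
  then show "stream_all2 P s t"
  proof (coinduction arbitrary: s t, goal_cases)
    case (1 s t)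
    then have "P (s !! 0) (t !! 0)" "\<And>n. P (s !! Suc n) (t !! Suc n)" by blast+
    then show ?case by simp
  qed
qed

text \<open>Induction on the position compared: past the first block it becomes an earlier position
  of \<open>after_zero \<xi>\<close>, which again has infinitely many zeros.\<close>

lemma flat_blocks:
  assumes "\<forall>n. \<exists>k\<ge>n. \<xi> !! k = 0"
  shows "\<xi> = flat (smap zero_ended (smap (\<lambda>\<zeta>. stake (zero_pos \<zeta>) \<zeta>) (siterate after_zero \<xi>)))"
    (is "_ = ?F \<xi>")
proof -
  have "\<xi> !! n = ?F \<xi> !! n" for n
    using assms
  proof (induction n arbitrary: \<xi> rule: less_induct)
    case (less n)
    obtain k where k: "\<xi> !! k = 0" using less.prems by blast
    let ?w = "zero_ended (stake (zero_pos \<xi>) \<xi>)"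
    have 1: "?F \<xi> = ?w @- ?F (after_zero \<xi>)"
      by (subst siterate.code) simp
    have 2: "\<xi> = ?w @- after_zero \<xi>" by (rule block_decomp[OF k])
    show ?case
    proof (cases "n < length ?w")
      case True
      have "\<xi> !! n = (?w @- after_zero \<xi>) !! n" using 2 by (rule arg_cong)
      also have "\<dots> = ?w ! n" by (rule shift_snth_less[OF True])
      also have "\<dots> = ?F \<xi> !! n" unfolding 1 by (rule shift_snth_less[OF True, symmetric])
      finally show ?thesis .
    next
      case False
      have "\<forall>n. \<exists>k\<ge>n. after_zero \<xi> !! k = 0"
      proof
        fix n
        obtain k where "k \<ge> Suc (zero_pos \<xi>) + n" "\<xi> !! k = 0" using less.prems by blast
        then show "\<exists>k\<ge>n. after_zero \<xi> !! k = 0"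
          by (intro exI[of _ "k - Suc (zero_pos \<xi>)"]) (simp add: after_zero_def sdrop_snth del: sdrop.simps)
      qed
      then have IH: "after_zero \<xi> !! (n - length ?w) = ?F (after_zero \<xi>) !! (n - length ?w)"
        using False by (intro less.IH) auto
      have n: "length ?w \<le> n" using False by (rule leI)
      have "\<xi> !! n = (?w @- after_zero \<xi>) !! n" using 2 by (rule arg_cong)
      also have "\<dots> = after_zero \<xi> !! (n - length ?w)" by (rule shift_snth_ge[OF n])
      also have "\<dots> = ?F (after_zero \<xi>) !! (n - length ?w)" by (rule IH)
      also have "\<dots> = ?F \<xi> !! n" unfolding 1 by (rule shift_snth_ge[OF n, symmetric])
      finally show ?thesis .
    qed
  qed
  then show ?thesis unfolding stream_eq_iff_snth by blast
qed

lemma compatible_block: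
  assumes "compat_block d w w'" "compatible d \<xi> \<eta>"
  shows "compatible d (zero_ended w @- \<xi>) (zero_ended w' @- \<eta>)"
  using assms(2) unfolding compatible_def
proof (elim disjE exE conjE, goal_cases)
  case (1 ws ws')
  then show ?case using assms(1)
    by (intro disjI1 exI[of _ "w ## ws"] exI[of _ "w' ## ws'"]) simp
next
  case (2 ws ws' t t')
  then show ?case using assms(1)
    by (intro disjI2 exI[of _ "w # ws"] exI[of _ "w' # ws'"] exI[of _ t] exI[of _ t']) simp
qed

lemma compatible_if_same_leads:
  assumes "d \<ge> 2" "\<xi> \<in> boundary d" "\<eta> \<in> boundary d" "same_leads d \<xi> \<eta>"
  shows "compatible d \<xi> \<eta>"
proof (cases "\<forall>n. \<exists>k\<ge>n. \<xi> !! k = 0")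
  case True
  let ?T = "\<lambda>n. (after_zero ^^ n) :: nat stream \<Rightarrow> nat stream"
  let ?B = "\<lambda>\<xi>. smap (\<lambda>\<zeta>. stake (zero_pos \<zeta>) \<zeta>) (siterate after_zero \<xi>)"
  have after: "\<exists>m. after_zero \<zeta> = sdrop m \<zeta>" for \<zeta> unfolding after_zero_def by blast
  \<comment> \<open>Iterates are tails of the stream, so they inherit membership in the boundary and
    the infinitely many zeros.\<close>
  have sd: "\<exists>m. ?T n \<zeta> = sdrop m \<zeta>" for n \<zeta>
  proof (induction n)
    case 0 show ?case by (auto intro: exI[of _ 0])
  next
    case (Suc n)
    then obtain m where m: "?T n \<zeta> = sdrop m \<zeta>" ..
    obtain k where "after_zero (?T n \<zeta>) = sdrop k (?T n \<zeta>)" using after ..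
    then have "?T (Suc n) \<zeta> = sdrop (m + k) \<zeta>" unfolding m by (simp add: m)
    then show ?case ..
  qed
  have "same_leads d (?T n \<xi>) (?T n \<eta>)" for n
    by (induction n) (simp_all add: assms same_leads_after_zero)
  moreover have "?T n \<zeta> \<in> boundary d" if "\<zeta> \<in> boundary d" for n \<zeta>
    using sd[of n \<zeta>] boundary_sdrop[OF that] by fastforce
  then have "?T n \<xi> \<in> boundary d" "?T n \<eta> \<in> boundary d" for n
    using assms by blast+
  moreover have "\<exists>k. ?T n \<xi> !! k = 0" for n
  proof -
    obtain m where m: "?T n \<xi> = sdrop m \<xi>" using sd by blast
    obtain k where k: "k \<ge> m" "\<xi> !! k = 0" using True by blast
    then have "?T n \<xi> !! (k - m) = 0" by (simp add: m sdrop_snth)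
    then show ?thesis ..
  qed
  ultimately have "stream_all2 (compat_block d) (?B \<xi>) (?B \<eta>)"
    unfolding stream_all2_iff_snth snth_smap snth_siterate
    using compat_block_first[OF assms(1)] by blast
  moreover have "\<forall>n. \<exists>k\<ge>n. \<eta> !! k = 0" using True same_leads_zero[OF assms(4)] by simp
  then have "\<eta> = flat (smap zero_ended (?B \<eta>))" by (rule flat_blocks)
  ultimately show ?thesis using flat_blocks[OF True] unfolding compatible_def by blast
next
  case False
  then obtain n where "\<forall>k\<ge>n. \<xi> !! k \<noteq> 0" by (simp del: neq0_conv) blast
  then show ?thesis using assms(2-4)
  \<comment> \<open>Induction on a bound past which no zeros occur. Cutting off a block removes at
    least one letter, so \<open>n - 1\<close> bounds the rest.\<close>
  proof (induction n arbitrary: \<xi> \<eta> rule: less_induct)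
    case (less n)
    show ?case
    proof (cases "\<exists>k. \<xi> !! k = 0")
      case True
      then obtain k where k: "\<xi> !! k = 0" by blast
      then have n: "k < n" using less.prems(1) by (meson not_le)
      have k': "\<eta> !! k = 0" using k same_leads_zero[OF less.prems(4)] by blast
      have "compatible d (after_zero \<xi>) (after_zero \<eta>)"
      proof (rule less.IH[of "n - 1"])
        show "same_leads d (after_zero \<xi>) (after_zero \<eta>)"
          by (rule same_leads_after_zero[OF less.prems(4)])
        show "after_zero \<xi> \<in> boundary d" "after_zero \<eta> \<in> boundary d"
          unfolding after_zero_def by (intro boundary_sdrop less.prems)+
        show "\<forall>k\<ge>n - 1. after_zero \<xi> !! k \<noteq> 0"
        proof (intro allI impI)
          fix k assume "n - 1 \<le> k"
          then have "\<xi> !! (Suc (zero_pos \<xi>) + k) \<noteq> 0" using less.prems(1) by (simp del: snth.simps neq0_conv)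
          then show "after_zero \<xi> !! k \<noteq> 0" unfolding after_zero_def sdrop_snth .
        qed
      qed (use n in simp)
      then show ?thesis
        by (subst block_decomp[OF k], subst block_decomp[OF k'],
          intro compatible_block compat_block_first[OF assms(1) less.prems(2-4) k])
    next
      case False
      have "\<xi> \<in> streams (letters d - {0})" "\<eta> \<in> streams (letters d - {0})"
        using less.prems(2,3) False same_leads_zero[OF less.prems(4)]
        by (auto simp: streams_iff_snth boundary_def)
      then show ?thesis unfolding compatible_def
        by (intro disjI2 exI[of _ "[]"] exI[of _ \<xi>] exI[of _ \<eta>]) simp
    qed
  qed
qed

section \<open>Rotations and spinal automorphisms of the tree\<close>

definition add_head :: "nat \<Rightarrow> nat \<Rightarrow> nat list \<Rightarrow> nat list" where
  "add_head d k w = (case w of [] \<Rightarrow> [] | v # u \<Rightarrow> ((v + k) mod d) # u)"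

lemma add_head_simps [simp]:
  "add_head d k [] = []" "add_head d k (v # u) = ((v + k) mod d) # u"
  by (simp_all add: add_head_def)

text \<open>A recursive form of \<open>spine\<close>: \<kappa> n stands for the exponent of
  \<omega>_n(b), and each leading letter d - 1 passes on to the next exponent.\<close>

fun spine_word :: "nat \<Rightarrow> (nat \<Rightarrow> nat) \<Rightarrow> nat list \<Rightarrow> nat list" where
  "spine_word d \<kappa> [] = []"
| "spine_word d \<kappa> (x # w) =
    (if x = d - 1 then x # spine_word d (\<lambda>n. \<kappa> (Suc n)) w
     else if x = 0 then 0 # add_head d (\<kappa> 0) w
     else x # w)"

lemma words_simps [simp]:
  "[] \<in> words d" "x # w \<in> words d \<longleftrightarrow> x < d \<and> w \<in> words d"
  "u @ v \<in> words d \<longleftrightarrow> u \<in> words d \<and> v \<in> words d"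
  by (auto simp: words_def letters_def)

lemma add_head_words: "d > 0 \<Longrightarrow> w \<in> words d \<Longrightarrow> add_head d k w \<in> words d"
  by (cases w) auto

lemma spine_word_words: "d > 0 \<Longrightarrow> w \<in> words d \<Longrightarrow> spine_word d \<kappa> w \<in> words d"
  by (induction d \<kappa> w rule: spine_word.induct) (auto simp: add_head_words)

lemma add_head_add: "add_head d k (add_head d l w) = add_head d (k + l) w"
  by (cases w) (simp_all add: mod_simps ac_simps)

lemma spine_word_add:
  "d \<ge> 2 \<Longrightarrow> spine_word d \<kappa> (spine_word d \<mu> w) = spine_word d (\<lambda>n. \<kappa> n + \<mu> n) w"
  by (induction w arbitrary: \<kappa> \<mu>) (auto simp: add_head_add)

lemma add_head_mod: "add_head d (k mod d) w = add_head d k w"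
  by (cases w) (simp_all add: mod_simps)

lemma spine_word_mod: "spine_word d (\<lambda>n. \<kappa> n mod d) w = spine_word d \<kappa> w"
  by (induction w arbitrary: \<kappa>) (auto simp: add_head_mod)

lemma add_head_id: "w \<in> words d \<Longrightarrow> k mod d = 0 \<Longrightarrow> add_head d k w = w"
  by (subst add_head_mod[symmetric]) (cases w; simp)

lemma spine_word_id: "w \<in> words d \<Longrightarrow> (\<And>n. \<kappa> n mod d = 0) \<Longrightarrow> spine_word d \<kappa> w = w"
  by (induction w arbitrary: \<kappa>) (auto simp: add_head_id)

text \<open>A one-sided substitute for a tree automorphism: it preserves adjacency, and if the
  inverse is of this form too, the equivalence demanded by \<open>aut_tree\<close> follows.\<close>

definition prefix_map :: "nat \<Rightarrow> (nat list \<Rightarrow> nat list) \<Rightarrow> bool" where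
  "prefix_map d f \<longleftrightarrow> f [] = [] \<and> (\<forall>w\<in>words d. f w \<in> words d) \<and>
     (\<forall>u x. u \<in> words d \<longrightarrow> x < d \<longrightarrow> (\<exists>y<d. f (u @ [x]) = f u @ [y]))"

lemma prefix_map_add_head:
  assumes "d > 0"
  shows "prefix_map d (add_head d k)"
proof -
  have "\<exists>y<d. add_head d k (u @ [x]) = add_head d k u @ [y]" if "x < d" for u x
    using assms that by (cases u) auto
  then show ?thesis using assms by (simp add: prefix_map_def add_head_words)
qed

lemma prefix_map_spine_word:
  assumes "d > 0"
  shows "prefix_map d (spine_word d \<kappa>)"
proof -
  have "\<exists>y<d. spine_word d \<kappa> (u @ [x]) = spine_word d \<kappa> u @ [y]" if "u \<in> words d" "x < d" for u x
    using that
  proof (induction u arbitrary: \<kappa>)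
    case Nil
    then show ?case by auto
  next
    case (Cons v u)
    have "\<exists>y<d. add_head d (\<kappa> 0) (u @ [x]) = add_head d (\<kappa> 0) u @ [y]"
      using prefix_map_add_head[OF assms] Cons.prems unfolding prefix_map_def by simp
    moreover have "\<exists>y<d. spine_word d (\<lambda>n. \<kappa> (Suc n)) (u @ [x]) = spine_word d (\<lambda>n. \<kappa> (Suc n)) u @ [y]"
      using Cons by simp
    ultimately show ?case using Cons.prems by auto
  qed
  then show ?thesis using assms by (simp add: prefix_map_def spine_word_words)
qed

lemma prefix_map_adj:
  assumes "prefix_map d f" "u \<in> words d" "v \<in> words d" "tree_adj d u v"
  shows "tree_adj d (f u) (f v)"
proof -
  obtain x where x: "x < d" "v = u @ [x] \<or> u = v @ [x]"
    using assms(4) by (auto simp: tree_adj_def letters_def)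
  from x(2) show ?thesis
  proof
    assume "v = u @ [x]"
    then obtain y where "y < d" "f v = f u @ [y]" using assms x(1) unfolding prefix_map_def by blast
    then show ?thesis by (auto simp: tree_adj_def letters_def)
  next
    assume "u = v @ [x]"
    then obtain y where "y < d" "f u = f v @ [y]" using assms x(1) unfolding prefix_map_def by blast
    then show ?thesis by (auto simp: tree_adj_def letters_def)
  qed
qed

lemma restrict_in_aut_tree:
  assumes f: "prefix_map d f" and g: "prefix_map d g"
    and fg: "\<And>w. w \<in> words d \<Longrightarrow> f (g w) = w" and gf: "\<And>w. w \<in> words d \<Longrightarrow> g (f w) = w"
  shows "restrict f (words d) \<in> carrier (aut_tree d)"
proof -
  have w: "f w \<in> words d" "g w \<in> words d" if "w \<in> words d" for w
    using f g that by (simp_all add: prefix_map_def)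
  have "bij_betw f (words d) (words d)"
    by (rule bij_betw_byWitness[where f' = g]) (use fg gf w in auto)
  then have "restrict f (words d) \<in> Bij (words d)" by (simp add: Bij_def)
  moreover have "tree_adj d (f u) (f v) \<longleftrightarrow> tree_adj d u v" if "u \<in> words d" "v \<in> words d" for u v
    using prefix_map_adj[OF f that] prefix_map_adj[OF g w(1)[OF that(1)] w(1)[OF that(2)]] gf that by auto
  ultimately show ?thesis using f by (simp add: aut_tree_def prefix_map_def)
qed

lemma aut_tree_one: "\<one>\<^bsub>aut_tree d\<^esub> = (\<lambda>w\<in>words d. w)"
  by (simp add: aut_tree_def BijGroup_def)

lemma carrier_aut_tree_Bij: "g \<in> carrier (aut_tree d) \<Longrightarrow> g \<in> Bij (words d)"
  by (simp add: aut_tree_def)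

lemma aut_tree_mult:
  assumes "f \<in> carrier (aut_tree d)" "g \<in> carrier (aut_tree d)"
  shows "f \<otimes>\<^bsub>aut_tree d\<^esub> g = compose (words d) f g"
  using assms[THEN carrier_aut_tree_Bij] by (simp add: aut_tree_def BijGroup_def)

lemma group_aut_tree: "group (aut_tree d)"
proof -
  let ?C = "{g \<in> Bij (words d). g [] = [] \<and>
        (\<forall>u\<in>words d. \<forall>v\<in>words d. tree_adj d (g u) (g v) \<longleftrightarrow> tree_adj d u v)}"
  have "subgroup ?C (BijGroup (words d))"
  proof (rule group.subgroupI[OF group_BijGroup])
    show "?C \<subseteq> carrier (BijGroup (words d))" by (auto simp: BijGroup_def)
    have "(\<lambda>w\<in>words d. w) \<in> ?C" by (simp add: id_Bij)
    then show "?C \<noteq> {}" by blast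
  next
    fix g assume g: "g \<in> ?C"
    let ?i = "\<lambda>w\<in>words d. inv_into (words d) g w"
    have bij: "bij_betw g (words d) (words d)" using g by (simp add: Bij_def)
    then have im: "g ` words d = words d" and inj: "inj_on g (words d)"
      by (simp_all add: bij_betw_def)
    have i: "g (?i w) = w" "?i w \<in> words d" if "w \<in> words d" for w
      using that im by (simp_all add: f_inv_into_f inv_into_into)
    have "?i [] = []" using inj g inv_into_f_f[OF inj, of "[]"] by simp
    moreover have "tree_adj d (?i u) (?i v) \<longleftrightarrow> tree_adj d u v" if "u \<in> words d" "v \<in> words d" for u v
    proof -
      have "tree_adj d (g (?i u)) (g (?i v)) \<longleftrightarrow> tree_adj d (?i u) (?i v)"
        using g i(2)[OF that(1)] i(2)[OF that(2)] by blast
      then show ?thesis by (simp only: i(1)[OF that(1)] i(1)[OF that(2)])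
    qed
    moreover have "?i \<in> Bij (words d)" using g by (intro restrict_inv_into_Bij) simp
    ultimately have "?i \<in> ?C" by blast
    moreover have "inv\<^bsub>BijGroup (words d)\<^esub> g = ?i" using g by (intro inv_BijGroup) simp
    ultimately show "inv\<^bsub>BijGroup (words d)\<^esub> g \<in> ?C" by simp
  next
    fix g h assume g: "g \<in> ?C" and h: "h \<in> ?C"
    have hw: "h w \<in> words d" if "w \<in> words d" for w
      using h that Bij_imp_funcset[of h "words d"] by auto
    have "compose (words d) g h \<in> ?C"
      using g h hw by (simp add: compose_Bij compose_eq)
    then show "g \<otimes>\<^bsub>BijGroup (words d)\<^esub> h \<in> ?C" using g h by (simp add: BijGroup_def)
  qed
  then show ?thesis unfolding aut_tree_def
    by (rule group.subgroup_imp_group[OF group_BijGroup])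
qed

definition rot_pow :: "nat \<Rightarrow> nat \<Rightarrow> nat list \<Rightarrow> nat list" where
  "rot_pow d k = restrict (add_head d k) (words d)"

definition spine_map :: "nat \<Rightarrow> (nat \<Rightarrow> nat) \<Rightarrow> nat list \<Rightarrow> nat list" where
  "spine_map d \<kappa> = restrict (spine_word d \<kappa>) (words d)"

text \<open>Provides inverses without subtraction: modulo d, adding (d - 1) * k undoes adding
  k.\<close>

lemma add_multiple_mod: "(k + (d - 1) * k) mod d = 0" "((d - 1) * k + k) mod d = 0"
  if "d > 0" for k d :: nat
proof -
  have "k + (d - 1) * k = d * k" using that by (cases d) simp_all
  then show "(k + (d - 1) * k) mod d = 0" by simp
  then show "((d - 1) * k + k) mod d = 0" by (simp only: add.commute)
qed

lemma rot_pow_aut: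
  assumes "d > 0"
  shows "rot_pow d k \<in> carrier (aut_tree d)"
  unfolding rot_pow_def
proof (rule restrict_in_aut_tree[where g = "add_head d ((d - 1) * k)"])
  fix w assume "w \<in> words d"
  then show "add_head d k (add_head d ((d - 1) * k) w) = w" "add_head d ((d - 1) * k) (add_head d k w) = w"
    unfolding add_head_add
    by (simp_all only: add_head_id add_multiple_mod[OF assms])
qed (use assms in \<open>intro prefix_map_add_head; assumption\<close>)+

lemma spine_map_aut:
  assumes "d \<ge> 2"
  shows "spine_map d \<kappa> \<in> carrier (aut_tree d)"
  unfolding spine_map_def
proof (rule restrict_in_aut_tree[where g = "spine_word d (\<lambda>n. (d - 1) * \<kappa> n)"])
  fix w assume "w \<in> words d"
  then show "spine_word d \<kappa> (spine_word d (\<lambda>n. (d - 1) * \<kappa> n) w) = w"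
      "spine_word d (\<lambda>n. (d - 1) * \<kappa> n) (spine_word d \<kappa> w) = w"
    unfolding spine_word_add[OF assms] using assms
    by (simp_all only: spine_word_id add_multiple_mod)
qed (use assms in \<open>intro prefix_map_spine_word; simp\<close>)+

lemma rot_pow_mult:
  assumes "d > 0"
  shows "rot_pow d k \<otimes>\<^bsub>aut_tree d\<^esub> rot_pow d l = rot_pow d (k + l)"
  unfolding aut_tree_mult[OF rot_pow_aut[OF assms] rot_pow_aut[OF assms]]
  using assms by (auto simp: rot_pow_def compose_def add_head_words add_head_add restrict_def)

lemma spine_map_mult:
  assumes "d \<ge> 2"
  shows "spine_map d \<kappa> \<otimes>\<^bsub>aut_tree d\<^esub> spine_map d \<mu> = spine_map d (\<lambda>n. \<kappa> n + \<mu> n)"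
  unfolding aut_tree_mult[OF spine_map_aut[OF assms] spine_map_aut[OF assms]]
  using assms by (auto simp: spine_map_def compose_def spine_word_words spine_word_add restrict_def)

lemma rot_pow_mod: "rot_pow d (k mod d) = rot_pow d k"
  by (simp add: rot_pow_def add_head_mod[abs_def])

lemma rot_pow_0: "rot_pow d 0 = \<one>\<^bsub>aut_tree d\<^esub>"
  by (auto simp: rot_pow_def aut_tree_one add_head_id restrict_def)

lemma rot_eq_rot_pow: "rot d = rot_pow d 1"
  unfolding rot_def rot_pow_def add_head_def ..

lemma carrier_A_group:
  assumes "d > 0"
  shows "carrier (A_group d) = rot_pow d ` {..<d}"
proof -
  interpret group "aut_tree d" by (rule group_aut_tree)
  have A: "carrier (A_group d) = generate (aut_tree d) {rot d}"
    using rot_pow_aut[OF assms, of 1] by (simp add: A_group_def carrier_subgroup_generated rot_eq_rot_pow)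
  have im: "rot_pow d k \<in> rot_pow d ` {..<d}" for k
    by (rule image_eqI[where x = "k mod d"]) (use assms in \<open>simp_all add: rot_pow_mod\<close>)
  have "g \<in> rot_pow d ` {..<d}" if "g \<in> generate (aut_tree d) {rot d}" for g
    using that
  proof induction
    case one
    then show ?case by (metis im rot_pow_0)
  next
    case (incl h)
    then show ?case using im by (simp add: rot_eq_rot_pow)
  next
    case (inv h)
    have "inv\<^bsub>aut_tree d\<^esub> (rot_pow d 1) = rot_pow d (d - 1)"
    proof (rule inv_equality)
      have "rot_pow d (d - 1 + 1) = rot_pow d 0" using assms rot_pow_mod[of d d] by simp
      then show "rot_pow d (d - 1) \<otimes>\<^bsub>aut_tree d\<^esub> rot_pow d 1 = \<one>\<^bsub>aut_tree d\<^esub>"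
        using assms by (simp add: rot_pow_mult rot_pow_0)
    qed (simp_all add: rot_pow_aut assms)
    then show ?case using inv im by (simp add: rot_eq_rot_pow)
  next
    case (eng g h)
    then obtain k l where "g = rot_pow d k" "h = rot_pow d l" by blast
    then show ?case using im by (simp add: rot_pow_mult assms)
  qed
  moreover have "rot_pow d k \<in> generate (aut_tree d) {rot d}" for k
  proof (induction k)
    case 0
    then show ?case unfolding rot_pow_0 by (rule generate.one)
  next
    case (Suc k)
    have "rot_pow d (Suc k) = rot d \<otimes>\<^bsub>aut_tree d\<^esub> rot_pow d k"
      using assms by (simp add: rot_eq_rot_pow rot_pow_mult)
    then show ?case using Suc by (simp add: generate.eng generate.incl)
  qed
  ultimately show ?thesis unfolding A by blast
qed

text \<open>A power a^k sends the one-letter word 0 to k modulo d, so this recovers the exponent of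
  a power of the rotation.\<close>

definition amount :: "(nat list \<Rightarrow> nat list) \<Rightarrow> nat" where
  "amount g = hd (g [0])"

lemma amount_rot_pow: "d > 0 \<Longrightarrow> amount (rot_pow d k) = k mod d"
  by (simp add: amount_def rot_pow_def)

lemma A_group_amount:
  assumes "d > 0" "g \<in> carrier (A_group d)"
  shows "amount g < d" "g = rot_pow d (amount g)"
  using assms by (auto simp: carrier_A_group amount_rot_pow)

lemma A_group_mult: "g \<otimes>\<^bsub>A_group d\<^esub> h = g \<otimes>\<^bsub>aut_tree d\<^esub> h"
  by (simp add: A_group_def)

lemma group_B_group: "group (B_group d m)"
  by (simp add: B_group_def)

lemma finite_B_group: "d > 0 \<Longrightarrow> finite (carrier (B_group d m))"
  by (simp add: B_group_def carrier_integer_mod_group finite_PiE)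

lemma spine_word_eq:
  assumes "d \<ge> 2" "w \<in> words d"
  shows "spine_word d \<kappa> w =
    (let r = length (takeWhile (\<lambda>x. x = d - 1) w) in
     if r < length w \<and> w ! r = 0
     then replicate r (d - 1) @ 0 # add_head d (\<kappa> r) (drop (Suc r) w)
     else w)"
  using assms
proof (induction w arbitrary: \<kappa>)
  case (Cons x w)
  show ?case
  proof (cases "x = d - 1")
    case True
    then show ?thesis using Cons by (auto simp: Let_def)
  next
    case False
    then show ?thesis using Cons.prems by (auto simp: Let_def)
  qed
qed simp

locale spinal =
  fixes d m :: nat and \<omega> :: spinal_seq
  assumes d: "d \<ge> 3" and \<omega>: "\<omega> \<in> Omega d m"
begin

abbreviation B where "B \<equiv> B_group d m"

definition coeff :: "(nat \<Rightarrow> int) \<Rightarrow> nat \<Rightarrow> nat" where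
  "coeff b n = amount (\<omega> n b)"

lemma \<omega>_hom: "\<omega> n \<in> hom B (A_group d)" and \<omega>_surj: "\<omega> n ` carrier B = carrier (A_group d)"
  using \<omega> by (simp_all add: Omega_def epi_def)

lemma \<omega>_eq:
  assumes "b \<in> carrier B"
  shows "\<omega> n b = rot_pow d (coeff b n)" "coeff b n < d"
proof -
  have "\<omega> n b \<in> carrier (A_group d)" using \<omega>_surj assms by blast
  then show "\<omega> n b = rot_pow d (coeff b n)" "coeff b n < d"
    unfolding coeff_def using A_group_amount d by auto
qed

lemma coeff_surj:
  assumes "k < d"
  obtains b where "b \<in> carrier B" "coeff b n = k"
proof -
  have "rot_pow d k \<in> \<omega> n ` carrier B" unfolding \<omega>_surj using assms d by (simp add: carrier_A_group)
  then obtain b where "b \<in> carrier B" "\<omega> n b = rot_pow d k" by auto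
  then show thesis using that assms d by (simp add: coeff_def amount_rot_pow)
qed

lemma coeff_mult:
  assumes "b \<in> carrier B" "b' \<in> carrier B"
  shows "coeff (b \<otimes>\<^bsub>B\<^esub> b') n = (coeff b n + coeff b' n) mod d"
proof -
  have "\<omega> n (b \<otimes>\<^bsub>B\<^esub> b') = \<omega> n b \<otimes>\<^bsub>A_group d\<^esub> \<omega> n b'" using \<omega>_hom assms by (rule hom_mult)
  also have "\<dots> = rot_pow d (coeff b n + coeff b' n)"
    using d assms by (simp add: A_group_mult \<omega>_eq(1) rot_pow_mult)
  finally show ?thesis using d by (simp add: coeff_def amount_rot_pow)
qed

text \<open>Suffixes of words are words, so the restricted map \<omega>_r(b) acts on them as plain
  \<open>add_head\<close>. From here on b enters through its exponents
  \<open>coeff b\<close>.\<close>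

lemma spine_eq:
  assumes "b \<in> carrier B"
  shows "spine d \<omega> b = spine_map d (coeff b)"
proof
  fix w
  show "spine d \<omega> b w = spine_map d (coeff b) w"
  proof (cases "w \<in> words d")
    case True
    then have "drop n w \<in> words d" for n by (auto simp: words_def dest: in_set_dropD)
    then have "\<omega> r b (drop n w) = add_head d (coeff b r) (drop n w)" for r n
      using assms by (simp add: \<omega>_eq(1) rot_pow_def)
    then show ?thesis using True d
      by (simp add: spine_def spine_map_def spine_word_eq Let_def del: drop.simps)
  next
    case False
    then show ?thesis by (simp add: spine_def spine_map_def)
  qed
qed

lemma spine_hom: "spine d \<omega> \<in> hom B (aut_tree d)"
proof (rule homI)
  show "spine d \<omega> b \<in> carrier (aut_tree d)" if "b \<in> carrier B" for b
    using that d by (simp add: spine_eq spine_map_aut)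
  show "spine d \<omega> (b \<otimes>\<^bsub>B\<^esub> b') = spine d \<omega> b \<otimes>\<^bsub>aut_tree d\<^esub> spine d \<omega> b'"
    if "b \<in> carrier B" "b' \<in> carrier B" for b b'
  proof -
    interpret Bg: group B by (rule group_B_group)
    have "spine_map d (coeff (b \<otimes>\<^bsub>B\<^esub> b')) = spine_map d (\<lambda>n. coeff b n + coeff b' n)"
      unfolding coeff_mult[OF that] spine_map_def spine_word_mod ..
    then show ?thesis using that d by (simp add: spine_eq spine_map_mult)
  qed
qed

lemma spine_group_hom: "group_hom B (aut_tree d) (spine d \<omega>)"
  by (simp add: group_hom_def group_hom_axioms_def group_B_group group_aut_tree spine_hom)

end

section \<open>Action on the boundary and orbits\<close>

definition shift_at :: "nat \<Rightarrow> nat \<Rightarrow> nat \<Rightarrow> nat stream \<Rightarrow> nat stream" where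
  "shift_at d r k \<zeta> = stake r \<zeta> @- ((\<zeta> !! r + k) mod d) ## sdrop (Suc r) \<zeta>"

lemma shift_at_snth: "shift_at d r k \<zeta> !! i = (if i = r then (\<zeta> !! r + k) mod d else \<zeta> !! i)"
proof -
  consider "i < r" | "i = r" | "r < i" by linarith
  then show ?thesis
  proof cases
    case 3
    then obtain j where "i = r + Suc j" using less_iff_Suc_add by auto
    then show ?thesis by (simp add: shift_at_def sdrop_snth del: sdrop.simps)
  qed (simp_all add: shift_at_def shift_snth stake_nth)
qed

lemma shift_at_simps [simp]:
  "shift_at d 0 k (x ## \<zeta>) = ((x + k) mod d) ## \<zeta>"
  "shift_at d (Suc r) k (x ## \<zeta>) = x ## shift_at d r k \<zeta>"
  by (simp_all add: shift_at_def)

lemma sdrop_shift_at: "r < n \<Longrightarrow> sdrop n (shift_at d r k \<zeta>) = sdrop n \<zeta>"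
  by (simp add: sdrop_eq_iff_snth shift_at_snth)

lemma boundary_shift_at: "d > 0 \<Longrightarrow> \<zeta> \<in> boundary d \<Longrightarrow> shift_at d r k \<zeta> \<in> boundary d"
  by (simp add: boundary_def streams_iff_snth shift_at_snth letters_def)

lemma boundary_snth: "\<zeta> \<in> boundary d \<Longrightarrow> \<zeta> !! i < d"
  by (simp add: boundary_def streams_iff_snth letters_def)

lemma boundary_iff: "\<zeta> \<in> boundary d \<longleftrightarrow> (\<forall>i. \<zeta> !! i < d)"
  by (simp add: boundary_def streams_iff_snth letters_def)

lemma shift_at_exists:
  assumes "y \<in> boundary d" "z \<in> boundary d" "\<And>i. i \<noteq> r \<Longrightarrow> y !! i = z !! i"
  obtains k where "k < d" "z = shift_at d r k y"
proof -
  have lt: "y !! r < d" "z !! r < d" using assms boundary_snth by auto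
  \<comment> \<open>The difference of the two letters modulo d, with d added first to stay within
    the natural numbers.\<close>
  define k where "k = (z !! r + (d - y !! r)) mod d"
  have "(y !! r + k) mod d = (y !! r + (z !! r + (d - y !! r))) mod d" by (simp add: k_def mod_simps)
  also have "y !! r + (z !! r + (d - y !! r)) = z !! r + d" using lt by simp
  finally have "(y !! r + k) mod d = z !! r" using lt by simp
  then have "z = shift_at d r k y" using assms(3) by (auto simp: stream_eq_iff_snth shift_at_snth)
  moreover have "k < d" using lt by (simp add: k_def)
  ultimately show thesis using that by blast
qed

lemma shift_at_eq_iff:
  assumes "y \<in> boundary d" "k < d" "l < d"
  shows "shift_at d r k y = shift_at d r l y \<longleftrightarrow> k = l"
proof
  assume "shift_at d r k y = shift_at d r l y"
  then have "shift_at d r k y !! r = shift_at d r l y !! r" by simp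
  then have eq: "(y !! r + k) mod d = (y !! r + l) mod d" by (simp add: shift_at_snth)
  have "y !! r < d" by (rule boundary_snth[OF assms(1)])
  then have "(y !! r + j) mod d = (if y !! r + j < d then y !! r + j else y !! r + j - d)" if "j < d" for j
    using that by (simp add: mod_if)
  then show "k = l" using eq assms(2,3) by (auto split: if_splits)
qed simp

lemma shift_at_0:
  assumes "y \<in> boundary d"
  shows "shift_at d r 0 y = y"
  using boundary_snth[OF assms] by (simp add: stream_eq_iff_snth shift_at_snth)

lemma stake_shift_at_0: "stake n (shift_at d 0 k \<zeta>) = add_head d k (stake n \<zeta>)"
  by (cases n; cases \<zeta>) simp_all

lemma lead_Stream [simp]:
  "lead d 0 (x ## \<zeta>) \<longleftrightarrow> x = 0"
  "lead d (Suc r) (x ## \<zeta>) \<longleftrightarrow> x = d - 1 \<and> lead d r \<zeta>"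
  by (auto simp: lead_def less_Suc_eq_0_disj)

text \<open>Every prefix is covered, also one too short to contain the changed letter. Each leading
  d - 1 shifts \<kappa> by one, so after r of them \<kappa> r is applied.\<close>

lemma stake_shift_at_lead:
  assumes "d \<ge> 2" "lead d r \<zeta>"
  shows "stake n (shift_at d (Suc r) (\<kappa> r) \<zeta>) = spine_word d \<kappa> (stake n \<zeta>)"
  using assms(2)
proof (induction r arbitrary: \<zeta> n \<kappa>)
  case 0
  then show ?case using assms(1) stake_shift_at_0 by (cases n; cases \<zeta>) auto
next
  case (Suc r)
  obtain x \<zeta>' where "\<zeta> = x ## \<zeta>'" by (cases \<zeta>)
  then show ?case using Suc.prems Suc.IH[of \<zeta>' _ "\<lambda>n. \<kappa> (Suc n)"] by (cases n) simp_all
qed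

lemma stake_no_lead:
  assumes "d \<ge> 2" "\<forall>r. \<not> lead d r \<zeta>"
  shows "spine_word d \<kappa> (stake n \<zeta>) = stake n \<zeta>"
  using assms(2)
proof (induction n arbitrary: \<zeta> \<kappa>)
  case (Suc n)
  obtain x \<zeta>' where \<zeta>: "\<zeta> = x ## \<zeta>'" by (cases \<zeta>)
  have "x \<noteq> 0" using Suc.prems[rule_format, of 0] \<zeta> by simp
  moreover have "x \<noteq> d - 1 \<or> (\<forall>r. \<not> lead d r \<zeta>')"
    using Suc.prems \<zeta> lead_Stream(2) by blast
  ultimately show ?case using Suc.IH[of \<zeta>'] \<zeta> by auto
qed simp

lemma lead_unique:
  assumes "d \<ge> 2" "lead d r \<zeta>" "lead d s \<zeta>"
  shows "r = s"
proof -
  have "\<not> a < b" if "lead d a \<zeta>" "lead d b \<zeta>" for a b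
    using that assms(1) by (auto simp: lead_def)
  then show ?thesis using assms by (meson nat_neq_iff)
qed

lemma bdry_actI:
  assumes "\<And>n. stake n \<zeta>' = g (stake n \<zeta>)"
  shows "bdry_act g \<zeta> = \<zeta>'"
  unfolding bdry_act_def
proof (rule the_equality)
  fix \<zeta>'' assume "\<forall>n. stake n \<zeta>'' = g (stake n \<zeta>)"
  then have "stake n \<zeta>'' = stake n \<zeta>'" for n using assms by simp
  then have "stake (Suc n) \<zeta>'' ! n = stake (Suc n) \<zeta>' ! n" for n by simp
  then show "\<zeta>'' = \<zeta>'" unfolding stream_eq_iff_snth by (simp add: stake_nth del: stake.simps)
qed (use assms in simp)

lemma stake_in_words: "\<zeta> \<in> boundary d \<Longrightarrow> stake n \<zeta> \<in> words d"
  by (auto simp: words_def in_set_conv_nth boundary_def streams_iff_snth stake_nth)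

text \<open>As \<open>bdry_act\<close> is a definite description, a witness for its value is carried
  along; it is required to lie in the boundary so that witnesses compose.\<close>

definition acts_to :: "nat \<Rightarrow> (nat list \<Rightarrow> nat list) \<Rightarrow> nat stream \<Rightarrow> nat stream \<Rightarrow> bool" where
  "acts_to d g \<zeta> \<zeta>' \<longleftrightarrow> \<zeta>' \<in> boundary d \<and> (\<forall>n. stake n \<zeta>' = g (stake n \<zeta>))"

lemma acts_to_bdry_act: "acts_to d g \<zeta> \<zeta>' \<Longrightarrow> bdry_act g \<zeta> = \<zeta>'"
  unfolding acts_to_def by (intro bdry_actI) blast

lemma acts_to_rot_pow:
  "d > 0 \<Longrightarrow> \<zeta> \<in> boundary d \<Longrightarrow> acts_to d (rot_pow d k) \<zeta> (shift_at d 0 k \<zeta>)"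
  by (simp add: acts_to_def boundary_shift_at stake_shift_at_0 rot_pow_def stake_in_words)

lemma acts_to_spine_map:
  assumes "d \<ge> 2" "\<zeta> \<in> boundary d"
  shows "lead d r \<zeta> \<Longrightarrow> acts_to d (spine_map d \<kappa>) \<zeta> (shift_at d (Suc r) (\<kappa> r) \<zeta>)"
    and "\<forall>r. \<not> lead d r \<zeta> \<Longrightarrow> acts_to d (spine_map d \<kappa>) \<zeta> \<zeta>"
  using assms by (simp_all add: acts_to_def boundary_shift_at stake_shift_at_lead
      stake_no_lead spine_map_def stake_in_words del: stake.simps)

lemma acts_to_mult:
  assumes "f \<in> carrier (aut_tree d)" "g \<in> carrier (aut_tree d)" "\<zeta> \<in> boundary d"
    "acts_to d g \<zeta> \<zeta>'" "acts_to d f \<zeta>' \<zeta>''"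
  shows "acts_to d (f \<otimes>\<^bsub>aut_tree d\<^esub> g) \<zeta> \<zeta>''"
  using assms by (auto simp: acts_to_def aut_tree_mult compose_eq stake_in_words)

section \<open>Orbits as classes of points with a common tail\<close>

definition tail_class :: "nat \<Rightarrow> nat stream \<Rightarrow> nat stream set" where
  "tail_class d \<xi> = {\<zeta> \<in> boundary d. \<exists>n. sdrop n \<zeta> = sdrop n \<xi>}"

lemma tail_class_trans:
  assumes "\<zeta> \<in> tail_class d \<xi>" "\<zeta>' \<in> boundary d" "sdrop n \<zeta>' = sdrop n \<zeta>"
  shows "\<zeta>' \<in> tail_class d \<xi>"
proof -
  obtain k where "sdrop k \<zeta> = sdrop k \<xi>" using assms(1) by (auto simp: tail_class_def)
  then have "sdrop (n + k) \<zeta>' = sdrop (n + k) \<xi>"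
    using sdrop_eq_mono[OF assms(3), of "n + k"] sdrop_eq_mono[of k \<zeta> \<xi> "n + k"] by simp
  then show ?thesis using assms(2) unfolding tail_class_def by blast
qed

text \<open>On boundary points this is the orbit relation of B: related points share the exponent r
  and may differ only at position r + 1; points without an exponent are fixed by B.\<close>

definition spine_rel :: "nat \<Rightarrow> nat stream \<Rightarrow> nat stream \<Rightarrow> bool" where
  "spine_rel d y z \<longleftrightarrow> y = z \<or>
     (\<exists>r. lead d r y \<and> lead d r z \<and> sdrop (Suc (Suc r)) y = sdrop (Suc (Suc r)) z)"

lemma lead_shift_at: "lead d r y \<Longrightarrow> lead d r (shift_at d (Suc r) k y)"
  by (simp add: lead_def shift_at_snth)

context spinal begin

lemma act_rot_pow: "y \<in> boundary d \<Longrightarrow> bdry_act (rot_pow d k) y = shift_at d 0 k y"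
  using d by (intro acts_to_bdry_act[OF acts_to_rot_pow]) simp_all

lemma act_spine:
  assumes "b \<in> carrier B" "y \<in> boundary d"
  shows "lead d r y \<Longrightarrow> bdry_act (spine d \<omega> b) y = shift_at d (Suc r) (coeff b r) y"
    and "\<forall>r. \<not> lead d r y \<Longrightarrow> bdry_act (spine d \<omega> b) y = y"
  using acts_to_bdry_act[OF acts_to_spine_map(1)] acts_to_bdry_act[OF acts_to_spine_map(2)] assms d
  by (simp_all add: spine_eq)

lemma generators_aut: "carrier (A_group d) \<union> B_image d m \<omega> \<subseteq> carrier (aut_tree d)"
  using d by (auto simp: carrier_A_group rot_pow_aut B_image_def spine_eq spine_map_aut)

lemma carrier_spinal_group:
  "carrier (spinal_group d m \<omega>) = generate (aut_tree d) (carrier (A_group d) \<union> B_image d m \<omega>)"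
  using generators_aut by (simp add: spinal_group_def carrier_subgroup_generated Int_absorb1)

lemma generator_acts:
  assumes "g \<in> carrier (A_group d) \<union> B_image d m \<omega>" "\<zeta> \<in> boundary d"
  shows "\<exists>\<zeta>'. acts_to d g \<zeta> \<zeta>' \<and> (\<exists>n. sdrop n \<zeta>' = sdrop n \<zeta>)"
  using assms(1)
proof
  assume "g \<in> carrier (A_group d)"
  then obtain k where "g = rot_pow d k" using d by (auto simp: carrier_A_group)
  then show ?thesis using acts_to_rot_pow[of d \<zeta> k] sdrop_shift_at[of 0 1] d assms(2) by fastforce
next
  assume "g \<in> B_image d m \<omega>"
  then obtain b where b: "b \<in> carrier B" "g = spine_map d (coeff b)" by (auto simp: B_image_def spine_eq)
  show ?thesis
  proof (cases "\<exists>r. lead d r \<zeta>")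
    case True
    then obtain r where r: "lead d r \<zeta>" ..
    show ?thesis unfolding b
    proof (intro exI conjI)
      show "acts_to d (spine_map d (coeff b)) \<zeta> (shift_at d (Suc r) (coeff b r) \<zeta>)"
        using d assms(2) r by (intro acts_to_spine_map) auto
      show "sdrop (Suc (Suc r)) (shift_at d (Suc r) (coeff b r) \<zeta>) = sdrop (Suc (Suc r)) \<zeta>"
        by (rule sdrop_shift_at) simp
    qed
  next
    case False
    then have "acts_to d (spine_map d (coeff b)) \<zeta> \<zeta>"
      using d assms(2) by (intro acts_to_spine_map) auto
    then show ?thesis unfolding b by blast
  qed
qed

text \<open>Reduces the \<open>inv\<close> case of \<open>generate\<close> to the
  \<open>incl\<close> case: A is a group, and the other generators form the image of a
  homomorphism.\<close>

lemma generator_inv: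
  assumes "g \<in> carrier (A_group d) \<union> B_image d m \<omega>"
  shows "inv\<^bsub>aut_tree d\<^esub> g \<in> carrier (A_group d) \<union> B_image d m \<omega>"
  using assms
proof
  interpret group "aut_tree d" by (rule group_aut_tree)
  assume "g \<in> carrier (A_group d)"
  moreover have "carrier (A_group d) = generate (aut_tree d) {rot d}"
    using rot_pow_aut[of d 1] d by (simp add: A_group_def carrier_subgroup_generated rot_eq_rot_pow)
  ultimately show ?thesis
    using generate_m_inv_closed[of "{rot d}" g] rot_pow_aut[of d 1] d by (simp add: rot_eq_rot_pow)
next
  interpret group_hom B "aut_tree d" "spine d \<omega>" by (rule spine_group_hom)
  assume "g \<in> B_image d m \<omega>"
  then obtain b where "b \<in> carrier B" "g = spine d \<omega> b" by (auto simp: B_image_def)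
  then have "inv\<^bsub>aut_tree d\<^esub> g = spine d \<omega> (inv\<^bsub>B\<^esub> b)" "inv\<^bsub>B\<^esub> b \<in> carrier B"
    using hom_inv by simp_all
  then show ?thesis by (simp add: B_image_def)
qed

lemma spinal_group_acts:
  assumes "g \<in> carrier (spinal_group d m \<omega>)" "\<zeta> \<in> boundary d"
  shows "\<exists>\<zeta>'. acts_to d g \<zeta> \<zeta>' \<and> (\<exists>n. sdrop n \<zeta>' = sdrop n \<zeta>)"
  using assms unfolding carrier_spinal_group
proof (induction arbitrary: \<zeta>)
  case one
  then have "acts_to d \<one>\<^bsub>aut_tree d\<^esub> \<zeta> \<zeta>" by (simp add: acts_to_def aut_tree_one stake_in_words)
  then show ?case by blast
next
  case (incl h)
  then show ?case by (intro generator_acts)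
next
  case (inv h)
  then show ?case by (intro generator_acts generator_inv)
next
  case (eng g h)
  obtain \<zeta>' n where 1: "acts_to d h \<zeta> \<zeta>'" "sdrop n \<zeta>' = sdrop n \<zeta>" using eng.IH(2) eng.prems by blast
  then have "\<zeta>' \<in> boundary d" by (simp add: acts_to_def)
  then obtain \<zeta>'' k where 2: "acts_to d g \<zeta>' \<zeta>''" "sdrop k \<zeta>'' = sdrop k \<zeta>'" using eng.IH(1) by blast
  have "g \<in> carrier (aut_tree d)" "h \<in> carrier (aut_tree d)"
    using eng.hyps group.generate_in_carrier[OF group_aut_tree generators_aut] by blast+
  then have "acts_to d (g \<otimes>\<^bsub>aut_tree d\<^esub> h) \<zeta> \<zeta>''"
    using acts_to_mult eng.prems 1 2 by blast
  moreover have "sdrop (n + k) \<zeta>'' = sdrop (n + k) \<zeta>"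
    using sdrop_eq_mono[OF 1(2), of "n + k"] sdrop_eq_mono[OF 2(2), of "n + k"] by simp
  ultimately show ?case by blast
qed

lemma orbit_subset:
  assumes "\<xi> \<in> boundary d"
  shows "orbit (spinal_group d m \<omega>) bdry_act \<xi> \<subseteq> tail_class d \<xi>"
proof
  fix \<zeta> assume "\<zeta> \<in> orbit (spinal_group d m \<omega>) bdry_act \<xi>"
  then obtain g where g: "g \<in> carrier (spinal_group d m \<omega>)" "\<zeta> = bdry_act g \<xi>" by (auto simp: orbit_def)
  obtain \<zeta>' n where "acts_to d g \<xi> \<zeta>'" "sdrop n \<zeta>' = sdrop n \<xi>"
    using spinal_group_acts[OF g(1) assms] by blast
  then show "\<zeta> \<in> tail_class d \<xi>" using g(2) acts_to_bdry_act by (auto simp: tail_class_def acts_to_def)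
qed

lemma orbit_generator:
  assumes "\<xi> \<in> boundary d" "\<zeta> \<in> orbit (spinal_group d m \<omega>) bdry_act \<xi>"
    "s \<in> carrier (A_group d) \<union> B_image d m \<omega>"
  shows "bdry_act s \<zeta> \<in> orbit (spinal_group d m \<omega>) bdry_act \<xi>"
proof -
  obtain g where g: "g \<in> carrier (spinal_group d m \<omega>)" "\<zeta> = bdry_act g \<xi>"
    using assms(2) by (auto simp: orbit_def)
  obtain \<zeta>' where 1: "acts_to d g \<xi> \<zeta>'" using spinal_group_acts[OF g(1) assms(1)] by blast
  then have z: "\<zeta> = \<zeta>'" "\<zeta>' \<in> boundary d" using g(2) acts_to_bdry_act by (auto simp: acts_to_def)
  then obtain \<zeta>'' where 2: "acts_to d s \<zeta>' \<zeta>''" using generator_acts assms(3) by blast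
  have gs: "g \<in> carrier (aut_tree d)" "s \<in> carrier (aut_tree d)"
    using group.generate_in_carrier[OF group_aut_tree generators_aut g(1)[unfolded carrier_spinal_group]]
      generators_aut assms(3) by auto
  have "bdry_act s \<zeta> = bdry_act (s \<otimes>\<^bsub>aut_tree d\<^esub> g) \<xi>"
    using acts_to_bdry_act[OF 2] acts_to_bdry_act[OF acts_to_mult[OF gs(2,1) assms(1) 1 2]] z by simp
  moreover have "s \<otimes>\<^bsub>aut_tree d\<^esub> g \<in> carrier (spinal_group d m \<omega>)"
    using generate.eng[OF generate.incl[OF assms(3)] g(1)[unfolded carrier_spinal_group]]
    unfolding carrier_spinal_group .
  ultimately show ?thesis by (auto simp: orbit_def)
qed

text \<open>Letter 0 is corrected by a rotation. To correct letter r + 1, the induction hypothesis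
  first moves to the prefix (d-1)^r 0, then B changes the letter, and the induction hypothesis
  restores the wanted prefix.\<close>

lemma orbit_transitive:
  assumes \<xi>: "\<xi> \<in> boundary d" and "\<zeta> \<in> orbit (spinal_group d m \<omega>) bdry_act \<xi>"
    and "\<zeta>' \<in> boundary d" and "sdrop n \<zeta>' = sdrop n \<zeta>"
  shows "\<zeta>' \<in> orbit (spinal_group d m \<omega>) bdry_act \<xi>"
  using assms(2-4)
proof (induction n arbitrary: \<zeta> \<zeta>')
  case 0
  then show ?case by simp
next
  case (Suc n)
  have \<zeta>: "\<zeta> \<in> boundary d" using orbit_subset[OF \<xi>] Suc.prems(1) by (auto simp: tail_class_def)
  show ?case
  proof (cases n)
    case 0
    have "\<zeta> !! i = \<zeta>' !! i" if "i \<noteq> 0" for i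
      using Suc.prems(3) that unfolding sdrop_eq_iff_snth 0 by simp
    then obtain k where k: "k < d" "\<zeta>' = shift_at d 0 k \<zeta>"
      using shift_at_exists[OF \<zeta> Suc.prems(2), of 0] by metis
    have "rot_pow d k \<in> carrier (A_group d)" using k(1) d by (simp add: carrier_A_group)
    then have "bdry_act (rot_pow d k) \<zeta> \<in> orbit (spinal_group d m \<omega>) bdry_act \<xi>"
      using orbit_generator[OF \<xi> Suc.prems(1)] by blast
    then show ?thesis using k \<zeta> by (simp add: act_rot_pow)
  next
    case (Suc r)
    let ?p = "\<lambda>\<zeta>. (replicate r (d - 1) @ [0]) @- sdrop (Suc r) \<zeta>"
    have lead_p: "lead d r (?p \<zeta>)" for \<zeta> by (auto simp: lead_def shift_snth nth_append)
    have bdry_p: "?p \<zeta> \<in> boundary d" if "\<zeta> \<in> boundary d" for \<zeta>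
      using boundary_sdrop[OF that, of "Suc r"] d unfolding boundary_def
      by (intro shift_streams) (auto simp: letters_def)
    have drop_p: "sdrop (Suc r) (?p \<zeta>) = sdrop (Suc r) \<zeta>" for \<zeta>
      by (subst sdrop_shift) simp
    have 1: "?p \<zeta> \<in> orbit (spinal_group d m \<omega>) bdry_act \<xi>"
      using Suc.IH[OF Suc.prems(1) bdry_p[OF \<zeta>]] drop_p unfolding \<open>n = Suc r\<close> by blast
    have p_eq: "?p \<zeta> !! i = ?p \<zeta>' !! i" if "i \<noteq> Suc r" for i
    proof (cases "i < Suc r")
      case True
      then show ?thesis by (simp add: shift_snth)
    next
      case False
      then have "Suc (Suc r) \<le> i" using that by simp
      then have "\<zeta> !! i = \<zeta>' !! i"
        using Suc.prems(3) unfolding \<open>n = Suc r\<close> sdrop_eq_iff_snth by simp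
      then show ?thesis using drop_p[of \<zeta>] drop_p[of \<zeta>'] False unfolding sdrop_eq_iff_snth by simp
    qed
    obtain k where k: "k < d" "?p \<zeta>' = shift_at d (Suc r) k (?p \<zeta>)"
      by (rule shift_at_exists[OF bdry_p[OF \<zeta>] bdry_p[OF Suc.prems(2)] p_eq])
    \<comment> \<open>Surjectivity of \<omega>_r supplies an element of B that adds exactly
      k.\<close>
    obtain b where b: "b \<in> carrier B" "coeff b r = k" by (rule coeff_surj[OF k(1)])
    have "bdry_act (spine d \<omega> b) (?p \<zeta>) \<in> orbit (spinal_group d m \<omega>) bdry_act \<xi>"
      using orbit_generator[OF \<xi> 1] b(1) by (simp add: B_image_def)
    then have "?p \<zeta>' \<in> orbit (spinal_group d m \<omega>) bdry_act \<xi>"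
      using act_spine(1)[OF b(1) bdry_p[OF \<zeta>] lead_p] k b by simp
    then show ?thesis
      using Suc.IH[OF _ Suc.prems(2)] drop_p[of \<zeta>'] unfolding \<open>n = Suc r\<close> by simp
  qed
qed

lemma orbit_eq:
  assumes "\<xi> \<in> boundary d"
  shows "orbit (spinal_group d m \<omega>) bdry_act \<xi> = tail_class d \<xi>"
proof
  have "\<one>\<^bsub>aut_tree d\<^esub> \<in> carrier (spinal_group d m \<omega>)"
    unfolding carrier_spinal_group by (rule generate.one)
  moreover have "acts_to d \<one>\<^bsub>aut_tree d\<^esub> \<xi> \<xi>"
    using assms by (simp add: acts_to_def aut_tree_one stake_in_words)
  ultimately have "\<xi> \<in> orbit (spinal_group d m \<omega>) bdry_act \<xi>"
    using acts_to_bdry_act by (force simp: orbit_def)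
  then show "tail_class d \<xi> \<subseteq> orbit (spinal_group d m \<omega>) bdry_act \<xi>"
    using orbit_transitive[OF assms] by (auto simp: tail_class_def)
qed (rule orbit_subset[OF assms])

end

section \<open>Edge multiplicities\<close>

lemma stl_eq_iff_snth: "stl s = stl t \<longleftrightarrow> (\<forall>i>0. s !! i = t !! i)"
  using sdrop_eq_iff_snth[of "Suc 0" s t] by (simp add: Suc_le_eq)

text \<open>Spine-related points share their first letter, which is 0 for r = 0 and d - 1 otherwise.
  So cliques of the two kinds meet in at most one point, and edges between distinct points are of
  one kind only.\<close>

lemma stl_spine_rel_eq:
  assumes "stl y = stl z" "spine_rel d y z"
  shows "y = z"
proof -
  have "y !! 0 = z !! 0" using assms(2) unfolding spine_rel_def lead_def by (metis not_gr0)
  then show ?thesis using assms(1) by (metis snth.simps(1) stream.expand)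
qed

lemma spine_rel_sym: "spine_rel d y z \<longleftrightarrow> spine_rel d z y"
  unfolding spine_rel_def by metis

lemma spine_rel_lead:
  assumes "d \<ge> 2" "spine_rel d y z" "lead d r y"
  shows "lead d r z" "sdrop (Suc (Suc r)) y = sdrop (Suc (Suc r)) z"
proof -
  have "y = z \<or> (lead d r z \<and> sdrop (Suc (Suc r)) y = sdrop (Suc (Suc r)) z)"
    using assms lead_unique unfolding spine_rel_def by blast
  then show "lead d r z" "sdrop (Suc (Suc r)) y = sdrop (Suc (Suc r)) z" using assms(3) by auto
qed

context spinal begin

abbreviation S where "S \<equiv> spinal_gens d m \<omega>"

definition fibre :: "nat stream \<Rightarrow> nat stream \<Rightarrow> (nat list \<Rightarrow> nat list) set" where
  "fibre y z = {s \<in> S. bdry_act s y = z}"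

text \<open>The image of Ker \<omega>_r, which stabilizes every boundary point of exponent r. It
  contains the identity, which \<open>S\<close> omits; hence loop counts subtract
  \<open>one_aut\<close>.\<close>

definition stab :: "nat \<Rightarrow> (nat list \<Rightarrow> nat list) set" where
  "stab r = {spine d \<omega> b | b. b \<in> carrier B \<and> coeff b r = 0}"

abbreviation one_aut where "one_aut \<equiv> \<one>\<^bsub>aut_tree d\<^esub>"

lemma finite_B_image: "finite (B_image d m \<omega>)"
  using finite_B_group d by (simp add: B_image_def)

lemma finite_S: "finite S"
  using finite_B_image d by (simp add: spinal_gens_def carrier_A_group)

lemma stab_subset: "stab r \<subseteq> B_image d m \<omega>"
  by (auto simp: stab_def B_image_def)

lemma act_one: "y \<in> boundary d \<Longrightarrow> bdry_act one_aut y = y"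
  by (simp add: act_rot_pow shift_at_0 flip: rot_pow_0)

lemma S_cases:
  assumes "s \<in> S"
  obtains k where "s = rot_pow d k" "0 < k" "k < d" | b where "s = spine d \<omega> b" "b \<in> carrier B"
proof -
  have "s \<in> rot_pow d ` {..<d} \<or> s \<in> spine d \<omega> ` carrier B" and "s \<noteq> rot_pow d 0"
    using assms d by (auto simp: spinal_gens_def carrier_A_group B_image_def rot_pow_0)
  then show thesis using that by (metis gr0I imageE lessThan_iff)
qed

lemma act_rot_pow_stl: "y \<in> boundary d \<Longrightarrow> stl (bdry_act (rot_pow d k) y) = stl y"
  by (simp add: act_rot_pow stl_eq_iff_snth shift_at_snth)

lemma act_spine_rel:
  assumes "b \<in> carrier B" "y \<in> boundary d"
  shows "spine_rel d y (bdry_act (spine d \<omega> b) y)"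
proof (cases "\<exists>r. lead d r y")
  case True
  then obtain r where "lead d r y" ..
  moreover from this have "sdrop (Suc (Suc r)) y = sdrop (Suc (Suc r)) (shift_at d (Suc r) (coeff b r) y)"
    by (subst sdrop_shift_at) simp_all
  ultimately show ?thesis
    unfolding act_spine(1)[OF assms \<open>lead d r y\<close>] spine_rel_def using lead_shift_at by blast
next
  case False
  then show ?thesis using act_spine(2)[OF assms] by (simp add: spine_rel_def)
qed

lemma spine_rel_shift:
  assumes "y \<in> boundary d" "z \<in> boundary d" "spine_rel d y z" "lead d r y"
  obtains k where "k < d" "z = shift_at d (Suc r) k y"
proof (rule shift_at_exists[OF assms(1,2)])
  fix i assume i: "i \<noteq> Suc r"
  have z: "lead d r z" "sdrop (Suc (Suc r)) y = sdrop (Suc (Suc r)) z"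
    using spine_rel_lead[OF _ assms(3,4)] d by simp_all
  consider "i < r" | "i = r" | "Suc (Suc r) \<le> i" using i by linarith
  then show "y !! i = z !! i"
    using z assms(4) by cases (auto simp: lead_def sdrop_eq_iff_snth simp del: sdrop.simps)
qed (use that in auto)

lemma fibre_rot:
  assumes "y \<in> boundary d" "z \<in> boundary d" "y \<noteq> z" "stl y = stl z"
  shows "card (fibre y z) = 1"
proof -
  have "\<And>i. i \<noteq> 0 \<Longrightarrow> y !! i = z !! i" using assms(4) by (simp add: stl_eq_iff_snth)
  then obtain k where k: "k < d" "z = shift_at d 0 k y"
    by (rule shift_at_exists[OF assms(1,2)])
  have "fibre y z = {rot_pow d k}"
  proof (intro equalityI subsetI)
    fix s assume "s \<in> fibre y z"
    then have s: "s \<in> S" "bdry_act s y = z" by (simp_all add: fibre_def)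
    from s(1) show "s \<in> {rot_pow d k}"
    proof (cases rule: S_cases)
      case (1 l)
      then have "shift_at d 0 l y = shift_at d 0 k y"
        using s(2) k(2) assms(1) by (simp add: act_rot_pow)
      then show ?thesis using shift_at_eq_iff[OF assms(1)] 1 k(1) by simp
    next
      case (2 b)
      then have "spine_rel d y z" using act_spine_rel[OF _ assms(1)] s(2) by blast
      then show ?thesis using stl_spine_rel_eq assms(3,4) by blast
    qed
  next
    fix s assume "s \<in> {rot_pow d k}"
    then have s: "s = rot_pow d k" by simp
    have act: "bdry_act s y = z" using s k(2) assms(1) by (simp add: act_rot_pow)
    then have "s \<noteq> one_aut" using act_one[OF assms(1)] assms(3) by auto
    moreover have "s \<in> carrier (A_group d)" using s k(1) d by (simp add: carrier_A_group)
    ultimately show "s \<in> fibre y z" using act by (simp add: fibre_def spinal_gens_def)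
  qed
  then show ?thesis by simp
qed

text \<open>The set on the left is a coset of \<open>stab r\<close>: multiplication by some
  \<open>b0\<close> with coefficient k maps \<open>stab r\<close> bijectively onto it.\<close>

lemma card_coset_stab:
  assumes "k < d"
  shows "card {spine d \<omega> b | b. b \<in> carrier B \<and> coeff b r = k} = card (stab r)"
proof -
  interpret group_hom B "aut_tree d" "spine d \<omega>" by (rule spine_group_hom)
  obtain b0 where b0: "b0 \<in> carrier B" "coeff b0 r = k" by (rule coeff_surj[OF assms])
  let ?f = "\<lambda>g. spine d \<omega> b0 \<otimes>\<^bsub>aut_tree d\<^esub> g"
  have "{spine d \<omega> b | b. b \<in> carrier B \<and> coeff b r = k} = ?f ` stab r"
  proof (intro equalityI subsetI)
    fix s assume "s \<in> {spine d \<omega> b | b. b \<in> carrier B \<and> coeff b r = k}"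
    then obtain b where b: "s = spine d \<omega> b" "b \<in> carrier B" "coeff b r = k" by blast
    define c where "c = inv\<^bsub>B\<^esub> b0 \<otimes>\<^bsub>B\<^esub> b"
    have c: "c \<in> carrier B" "b0 \<otimes>\<^bsub>B\<^esub> c = b"
      using b0 b by (simp_all add: c_def G.m_assoc[symmetric])
    have "(k + coeff c r) mod d = k" using coeff_mult[OF b0(1) c(1), of r] c(2) b b0(2) by simp
    moreover have "coeff c r < d" by (rule \<omega>_eq(2)[OF c(1)])
    ultimately have "coeff c r = 0" using assms by (auto simp: mod_if split: if_splits)
    then have "spine d \<omega> c \<in> stab r" using c(1) by (auto simp: stab_def)
    moreover have "s = ?f (spine d \<omega> c)" using b(1) c b0(1) by (metis hom_mult)
    ultimately show "s \<in> ?f ` stab r" by blast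
  next
    fix s assume "s \<in> ?f ` stab r"
    then obtain c where c: "c \<in> carrier B" "coeff c r = 0" "s = ?f (spine d \<omega> c)"
      by (auto simp: stab_def)
    then have "s = spine d \<omega> (b0 \<otimes>\<^bsub>B\<^esub> c)" "b0 \<otimes>\<^bsub>B\<^esub> c \<in> carrier B" "coeff (b0 \<otimes>\<^bsub>B\<^esub> c) r = k"
      using b0 assms coeff_mult[OF b0(1) c(1)] by simp_all
    then show "s \<in> {spine d \<omega> b | b. b \<in> carrier B \<and> coeff b r = k}" by blast
  qed
  moreover have "inj_on ?f (stab r)"
    using b0(1) by (intro inj_onI) (auto simp: stab_def)
  ultimately show ?thesis by (simp add: card_image)
qed

lemma fibre_spine:
  assumes "y \<in> boundary d" "z \<in> boundary d" "y \<noteq> z" "spine_rel d y z" "lead d r y"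
  shows "card (fibre y z) = card (stab r)"
proof -
  obtain k where k: "k < d" "z = shift_at d (Suc r) k y" by (rule spine_rel_shift[OF assms(1,2,4,5)])
  have "fibre y z = {spine d \<omega> b | b. b \<in> carrier B \<and> coeff b r = k}"
  proof (intro equalityI subsetI)
    fix s assume "s \<in> fibre y z"
    then have s: "s \<in> S" "bdry_act s y = z" by (simp_all add: fibre_def)
    from s(1) show "s \<in> {spine d \<omega> b | b. b \<in> carrier B \<and> coeff b r = k}"
    proof (cases rule: S_cases)
      case (1 l)
      then have "stl y = stl z" using act_rot_pow_stl[OF assms(1)] s(2) by metis
      then show ?thesis using stl_spine_rel_eq assms(3,4) by blast
    next
      case (2 b)
      then have "shift_at d (Suc r) (coeff b r) y = shift_at d (Suc r) k y"
        using act_spine(1)[OF 2(2) assms(1,5)] s(2) k(2) by simp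
      then have "coeff b r = k" using shift_at_eq_iff[OF assms(1)] k(1) \<omega>_eq(2)[OF 2(2)] by simp
      then show ?thesis using 2 by blast
    qed
  next
    fix s assume "s \<in> {spine d \<omega> b | b. b \<in> carrier B \<and> coeff b r = k}"
    then obtain b where b: "s = spine d \<omega> b" "b \<in> carrier B" "coeff b r = k" by blast
    then have act: "bdry_act s y = z" using act_spine(1)[OF b(2) assms(1,5)] k(2) by simp
    then have "s \<noteq> one_aut" using act_one[OF assms(1)] assms(3) by auto
    then show "s \<in> fibre y z" using act b by (simp add: fibre_def spinal_gens_def B_image_def)
  qed
  then show ?thesis using card_coset_stab[OF k(1)] by simp
qed

lemma fibre_loop_subset:
  assumes "y \<in> boundary d"
  shows "fibre y y \<subseteq> B_image d m \<omega> - {one_aut}"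
proof
  fix s assume "s \<in> fibre y y"
  then have s: "s \<in> S" "bdry_act s y = y" by (simp_all add: fibre_def)
  from s(1) show "s \<in> B_image d m \<omega> - {one_aut}"
  proof (cases rule: S_cases)
    case (1 l)
    then have "shift_at d 0 l y = shift_at d 0 0 y"
      using s(2) assms by (simp add: act_rot_pow shift_at_0)
    then show ?thesis using shift_at_eq_iff[OF assms] 1 by simp
  next
    case (2 b)
    then show ?thesis using s(1) by (auto simp: B_image_def spinal_gens_def)
  qed
qed

lemma fibre_loop_lead:
  assumes "y \<in> boundary d" "lead d r y"
  shows "fibre y y = stab r - {one_aut}"
proof (intro equalityI subsetI)
  fix s assume s: "s \<in> fibre y y"
  then obtain b where b: "b \<in> carrier B" "s = spine d \<omega> b" "s \<noteq> one_aut"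
    using fibre_loop_subset[OF assms(1)] by (auto simp: B_image_def)
  have "shift_at d (Suc r) (coeff b r) y = shift_at d (Suc r) 0 y"
    using s act_spine(1)[OF b(1) assms] b(2) shift_at_0[OF assms(1)] by (simp add: fibre_def)
  then have "coeff b r = 0" using shift_at_eq_iff[OF assms(1) \<omega>_eq(2)[OF b(1)], of 0] d by simp
  then show "s \<in> stab r - {one_aut}" using b by (auto simp: stab_def)
next
  fix s assume "s \<in> stab r - {one_aut}"
  then obtain b where b: "b \<in> carrier B" "s = spine d \<omega> b" "s \<noteq> one_aut" "coeff b r = 0"
    by (auto simp: stab_def)
  then have "bdry_act s y = y" using act_spine(1)[OF b(1) assms] shift_at_0[OF assms(1)] by simp
  then show "s \<in> fibre y y" using b by (simp add: fibre_def spinal_gens_def B_image_def)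
qed

lemma fibre_loop_no_lead:
  assumes "y \<in> boundary d" "\<forall>r. \<not> lead d r y"
  shows "fibre y y = B_image d m \<omega> - {one_aut}"
proof
  show "B_image d m \<omega> - {one_aut} \<subseteq> fibre y y"
    using act_spine(2)[OF _ assms] by (auto simp: B_image_def fibre_def spinal_gens_def)
qed (rule fibre_loop_subset[OF assms(1)])

text \<open>An element of B with coefficient 1 moves the point, so it is a missing loop; finiteness
  of B then makes the inequality strict.\<close>

lemma fibre_loop_less:
  assumes "y \<in> boundary d" "lead d r y"
  shows "card (fibre y y) < card (B_image d m \<omega> - {one_aut})"
proof -
  obtain b where b: "b \<in> carrier B" "coeff b r = 1" using coeff_surj[of 1 r] d by auto
  have "bdry_act (spine d \<omega> b) y = shift_at d (Suc r) 1 y" using act_spine(1)[OF b(1) assms] b(2) by simp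
  also have "\<dots> \<noteq> shift_at d (Suc r) 0 y" using shift_at_eq_iff[OF assms(1), of 1 0] d by simp
  finally have "bdry_act (spine d \<omega> b) y \<noteq> y" using shift_at_0[OF assms(1)] by simp
  then have "spine d \<omega> b \<in> B_image d m \<omega> - {one_aut}" "spine d \<omega> b \<notin> fibre y y"
    using b(1) act_one[OF assms(1)] by (auto simp: B_image_def fibre_def)
  then have "fibre y y \<subset> B_image d m \<omega> - {one_aut}" using fibre_loop_subset[OF assms(1)] by blast
  then show ?thesis using finite_B_image by (intro psubset_card_mono) simp_all
qed

text \<open>Makes the existence of an exponent visible in the graph; which exponent it is has to be
  found differently.\<close>

lemma lead_iff_card_fibre:
  assumes "y \<in> boundary d"
  shows "(\<exists>r. lead d r y) \<longleftrightarrow> card (fibre y y) < card (B_image d m \<omega> - {one_aut})"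
  using fibre_loop_less[OF assms] fibre_loop_no_lead[OF assms] less_irrefl by metis

lemma fibre_nonempty:
  assumes "y \<in> boundary d" "s \<in> fibre y z"
  shows "stl y = stl z \<or> spine_rel d y z"
proof -
  have s: "s \<in> S" "bdry_act s y = z" using assms(2) by (simp_all add: fibre_def)
  from s(1) show ?thesis
  proof (cases rule: S_cases)
    case (1 l)
    then show ?thesis using act_rot_pow_stl[OF assms(1)] s(2) by metis
  next
    case (2 b)
    then show ?thesis using act_spine_rel[OF _ assms(1)] s(2) by blast
  qed
qed

lemma fibre_nonempty_iff:
  assumes "y \<in> boundary d" "z \<in> boundary d" "y \<noteq> z"
  shows "fibre y z \<noteq> {} \<longleftrightarrow> stl y = stl z \<or> spine_rel d y z"
proof
  assume "fibre y z \<noteq> {}"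
  then show "stl y = stl z \<or> spine_rel d y z" using fibre_nonempty[OF assms(1)] by blast
next
  assume "stl y = stl z \<or> spine_rel d y z"
  then show "fibre y z \<noteq> {}"
  proof
    assume "stl y = stl z"
    then have "card (fibre y z) = 1" by (rule fibre_rot[OF assms])
    then show ?thesis by auto
  next
    assume rel: "spine_rel d y z"
    then obtain r where r: "lead d r y" using assms(3) by (auto simp: spine_rel_def)
    obtain b where "b \<in> carrier B" "coeff b r = 0" using coeff_surj[of 0 r] d by auto
    then have "stab r \<noteq> {}" by (auto simp: stab_def)
    then have "card (stab r) \<noteq> 0" using finite_subset[OF stab_subset finite_B_image] by simp
    then show ?thesis using fibre_spine[OF assms rel r] by auto
  qed
qed

text \<open>Collects the data that determine a multiplicity. \<open>card (stab r)\<close> is left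
  unevaluated, so the exponents on both sides have to agree.\<close>

lemma card_fibre_eq:
  assumes y: "y \<in> boundary d" "y' \<in> boundary d" and z: "z \<in> boundary d" "z' \<in> boundary d"
    and eq: "y = z \<longleftrightarrow> y' = z'" and stl: "stl y = stl z \<longleftrightarrow> stl y' = stl z'"
    and rel: "spine_rel d y z \<longleftrightarrow> spine_rel d y' z'" and lead: "\<And>r. lead d r y \<longleftrightarrow> lead d r y'"
  shows "card (fibre y z) = card (fibre y' z')"
proof (cases "y = z")
  case True
  then have "y' = z'" using eq by simp
  show ?thesis
  proof (cases "\<exists>r. lead d r y")
    case True
    then obtain r where "lead d r y" "lead d r y'" using lead by blast
    then show ?thesis using \<open>y = z\<close> \<open>y' = z'\<close> y fibre_loop_lead by simp
  next
    case False
    then show ?thesis using \<open>y = z\<close> \<open>y' = z'\<close> y fibre_loop_no_lead lead by simp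
  qed
next
  case False
  then have "y' \<noteq> z'" using eq by simp
  consider "stl y = stl z" | "spine_rel d y z" | "stl y \<noteq> stl z" "\<not> spine_rel d y z" by blast
  then show ?thesis
  proof cases
    case 1
    then show ?thesis using fibre_rot False \<open>y' \<noteq> z'\<close> y z stl by simp
  next
    case 2
    then obtain r where "lead d r y" "lead d r y'" using lead False by (auto simp: spine_rel_def)
    then show ?thesis using fibre_spine False \<open>y' \<noteq> z'\<close> y z rel 2 by simp
  next
    case 3
    then have "fibre y z = {}" "fibre y' z' = {}"
      using fibre_nonempty_iff False \<open>y' \<noteq> z'\<close> y z rel stl by auto
    then show ?thesis by simp
  qed
qed

end

section \<open>From compatibility to an isomorphism\<close>

definition swap_tail :: "nat stream \<Rightarrow> nat stream \<Rightarrow> nat stream \<Rightarrow> nat stream" where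
  "swap_tail \<xi> \<eta> \<zeta> = smap (\<lambda>n. if sdrop (Suc n) \<zeta> = sdrop (Suc n) \<xi>
      then (if \<zeta> !! n = \<xi> !! n then \<eta> !! n else if \<zeta> !! n = \<eta> !! n then \<xi> !! n else \<zeta> !! n)
      else \<zeta> !! n) nats"

lemma swap_tail_snth: "swap_tail \<xi> \<eta> \<zeta> !! n = (if sdrop (Suc n) \<zeta> = sdrop (Suc n) \<xi>
      then (if \<zeta> !! n = \<xi> !! n then \<eta> !! n else if \<zeta> !! n = \<eta> !! n then \<xi> !! n else \<zeta> !! n)
      else \<zeta> !! n)"
proof -
  have "nats !! n = n" by (induction n) simp_all
  then show ?thesis unfolding swap_tail_def snth_smap by simp
qed

lemma swap_tail_root: "swap_tail \<xi> \<eta> \<xi> = \<eta>"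
  unfolding stream_eq_iff_snth swap_tail_snth by simp

lemma sdrop_Suc_eq_iff: "sdrop n s = sdrop n t \<longleftrightarrow> s !! n = t !! n \<and> sdrop (Suc n) s = sdrop (Suc n) t"
  unfolding sdrop_eq_iff_snth by (metis Suc_leD Suc_leI le_neq_implies_less order_refl)

text \<open>Letter n of the image depends only on the letters of the argument from n on.\<close>

lemma sdrop_swap_tail_cong:
  assumes "sdrop n \<zeta> = sdrop n \<zeta>'"
  shows "sdrop n (swap_tail \<xi> \<eta> \<zeta>) = sdrop n (swap_tail \<xi> \<eta> \<zeta>')"
proof -
  have "swap_tail \<xi> \<eta> \<zeta> !! i = swap_tail \<xi> \<eta> \<zeta>' !! i" if "n \<le> i" for i
  proof -
    have "sdrop i \<zeta> = sdrop i \<zeta>'" using assms that by (rule sdrop_eq_mono)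
    then have "\<zeta> !! i = \<zeta>' !! i" "sdrop (Suc i) \<zeta> = sdrop (Suc i) \<zeta>'"
      unfolding sdrop_Suc_eq_iff[of i \<zeta>] by blast+
    then show ?thesis unfolding swap_tail_snth by presburger
  qed
  then show ?thesis unfolding sdrop_eq_iff_snth by blast
qed

lemma sdrop_swap_tail_root:
  "sdrop n \<zeta> = sdrop n \<xi> \<Longrightarrow> sdrop n (swap_tail \<xi> \<eta> \<zeta>) = sdrop n \<eta>"
  using sdrop_swap_tail_cong[of n \<zeta> \<xi> \<xi> \<eta>] unfolding swap_tail_root .

lemma swap_tail_in_tail_class:
  assumes "\<xi> \<in> boundary d" "\<eta> \<in> boundary d" "\<zeta> \<in> tail_class d \<xi>"
  shows "swap_tail \<xi> \<eta> \<zeta> \<in> tail_class d \<eta>"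
proof -
  have z: "\<zeta> \<in> boundary d" using assms(3) by (simp add: tail_class_def)
  obtain n where "sdrop n \<zeta> = sdrop n \<xi>" using assms(3) by (auto simp: tail_class_def)
  then have "sdrop n (swap_tail \<xi> \<eta> \<zeta>) = sdrop n \<eta>" by (rule sdrop_swap_tail_root)
  moreover have "swap_tail \<xi> \<eta> \<zeta> \<in> boundary d"
    unfolding boundary_iff swap_tail_snth using assms(1,2) z by (simp add: boundary_snth del: sdrop.simps)
  ultimately show ?thesis unfolding tail_class_def by blast
qed

text \<open>Far enough out \<zeta> agrees with \<xi>. Descending from there, the exchange at each
  position j is injective, so an image letter \<eta>_j can come only from \<xi>_j.\<close>

lemma sdrop_swap_tail_iff:
  assumes "\<zeta> \<in> tail_class d \<xi>"
  shows "sdrop n (swap_tail \<xi> \<eta> \<zeta>) = sdrop n \<eta> \<longleftrightarrow> sdrop n \<zeta> = sdrop n \<xi>"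
proof
  assume L: "sdrop n (swap_tail \<xi> \<eta> \<zeta>) = sdrop n \<eta>"
  obtain k where k: "sdrop k \<zeta> = sdrop k \<xi>" using assms by (auto simp: tail_class_def)
  define m where "m = max n k"
  have "sdrop m \<zeta> = sdrop m \<xi>" using k by (rule sdrop_eq_mono) (simp add: m_def)
  moreover have "n \<le> m" by (simp add: m_def)
  ultimately show "sdrop n \<zeta> = sdrop n \<xi>"
  proof (induction "m - n" arbitrary: m)
    case (Suc i)
    then obtain j where j: "m = Suc j" "n \<le> j" "i = j - n" by (cases m) auto
    have 1: "sdrop (Suc j) \<zeta> = sdrop (Suc j) \<xi>" using Suc.prems(1) unfolding j(1) .
    have "sdrop j (swap_tail \<xi> \<eta> \<zeta>) = sdrop j \<eta>" using L j(2) by (rule sdrop_eq_mono)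
    then have "swap_tail \<xi> \<eta> \<zeta> !! j = \<eta> !! j" unfolding sdrop_Suc_eq_iff[of j] by blast
    then have "\<zeta> !! j = \<xi> !! j" unfolding swap_tail_snth using 1 by (simp split: if_splits del: sdrop.simps)
    then have "sdrop j \<zeta> = sdrop j \<xi>" using 1 unfolding sdrop_Suc_eq_iff[of j] by blast
    then show ?case using Suc.hyps(1)[OF j(3)] j(2) by blast
  qed simp
qed (rule sdrop_swap_tail_root)

text \<open>By \<open>sdrop_swap_tail_iff\<close> both maps are active at the same positions, and
  exchanging two letters is an involution.\<close>

lemma swap_tail_inverse:
  assumes "\<zeta> \<in> tail_class d \<xi>"
  shows "swap_tail \<eta> \<xi> (swap_tail \<xi> \<eta> \<zeta>) = \<zeta>"
proof -
  have "swap_tail \<eta> \<xi> (swap_tail \<xi> \<eta> \<zeta>) !! n = \<zeta> !! n" for n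
    unfolding swap_tail_snth[of \<eta> \<xi>] sdrop_swap_tail_iff[OF assms] swap_tail_snth[of \<xi> \<eta>]
    by (simp del: sdrop.simps)
  then show ?thesis unfolding stream_eq_iff_snth by blast
qed

lemma lead_sdrop_Suc:
  "lead d (Suc k) (sdrop n s) \<longleftrightarrow> s !! n = d - 1 \<and> lead d k (sdrop (Suc n) s)"
  using lead_Stream(2)[of d k "s !! n" "sdrop (Suc n) s"]
  by (metis sdrop_simps stream.collapse)

text \<open>No letter of the pattern changes: wherever the exchange is active, the letter of \<zeta>
  equals both \<xi>_i and \<eta>_i or neither of them. For i < r this follows by comparing the leads
  of \<xi> and \<eta> at i + 1 and at i.\<close>

lemma lead_swap_tail:
  assumes "same_leads d \<xi> \<eta>" "lead d r \<zeta>"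
  shows "lead d r (swap_tail \<xi> \<eta> \<zeta>)"
proof -
  have "swap_tail \<xi> \<eta> \<zeta> !! i = \<zeta> !! i" if i: "i \<le> r" for i
  proof (cases "sdrop (Suc i) \<zeta> = sdrop (Suc i) \<xi>")
    case True
    have "\<zeta> !! i = \<xi> !! i \<longleftrightarrow> \<zeta> !! i = \<eta> !! i"
    proof (cases "i = r")
      case True
      then have "\<zeta> !! i = 0" using assms(2) by (simp add: lead_def)
      then show ?thesis using same_leads_zero[OF assms(1), of i] by auto
    next
      case False
      then have r: "i < r" using i by simp
      have z: "\<zeta> !! i = d - 1" using assms(2) r unfolding lead_def by blast
      have "\<zeta> !! (Suc i + j) = d - 1" if "j < r - Suc i" for j
      proof -
        have "Suc i + j < r" using that by linarith
        then show ?thesis using assms(2) unfolding lead_def by blast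
      qed
      moreover have "\<zeta> !! (Suc i + (r - Suc i)) = 0" using assms(2) r by (simp add: lead_def del: snth.simps)
      ultimately have l: "lead d (r - Suc i) (sdrop (Suc i) \<zeta>)" unfolding lead_sdrop by blast
      have x: "lead d (r - Suc i) (sdrop (Suc i) \<xi>)" using True l by simp
      then have y: "lead d (r - Suc i) (sdrop (Suc i) \<eta>)" using assms(1) unfolding same_leads_def by blast
      have "lead d (Suc (r - Suc i)) (sdrop i \<xi>) \<longleftrightarrow> lead d (Suc (r - Suc i)) (sdrop i \<eta>)"
        using assms(1) unfolding same_leads_def by blast
      then have "\<xi> !! i = d - 1 \<longleftrightarrow> \<eta> !! i = d - 1" unfolding lead_sdrop_Suc using x y by blast
      then show ?thesis unfolding z by metis
    qed
    then show ?thesis unfolding swap_tail_snth by auto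
  next
    case False
    then show ?thesis unfolding swap_tail_snth by simp
  qed
  then show ?thesis using assms(2) by (simp add: lead_def)
qed

lemma spine_rel_swap_tail:
  assumes "same_leads d \<xi> \<eta>" "spine_rel d y z"
  shows "spine_rel d (swap_tail \<xi> \<eta> y) (swap_tail \<xi> \<eta> z)"
  using assms(2) unfolding spine_rel_def
  using lead_swap_tail[OF assms(1)] sdrop_swap_tail_cong by metis

lemma stl_swap_tail: "stl y = stl z \<Longrightarrow> stl (swap_tail \<xi> \<eta> y) = stl (swap_tail \<xi> \<eta> z)"
  using sdrop_swap_tail_cong[of "Suc 0" y z \<xi> \<eta>] by simp

section \<open>From an isomorphism to compatibility\<close>

text \<open>Distance at most one in the graph. Equality is included because a vertex may carry no
  loop, as happens for m = 1.\<close>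

definition unit_rel :: "nat \<Rightarrow> nat stream \<Rightarrow> nat stream \<Rightarrow> bool" where
  "unit_rel d y z \<longleftrightarrow> stl y = stl z \<or> spine_rel d y z"

lemma tail_class_replace:
  assumes "\<zeta> \<in> tail_class d \<xi>" "w \<in> words d"
  shows "w @- sdrop (length w) \<zeta> \<in> tail_class d \<xi>"
proof (rule tail_class_trans[OF assms(1)])
  have "\<zeta> \<in> boundary d" using assms(1) by (simp add: tail_class_def)
  then show "w @- sdrop (length w) \<zeta> \<in> boundary d"
    using assms(2) boundary_sdrop[of \<zeta> d "length w"] unfolding boundary_def words_def
    by (intro shift_streams)
  show "sdrop (length w) (w @- sdrop (length w) \<zeta>) = sdrop (length w) \<zeta>"
    by (simp add: sdrop_shift)
qed

text \<open>A vertex without an exponent has neighbours in its rotation clique only. Every rotation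
  clique has such a vertex, with first letter 1, which differs from 0 and from d - 1.\<close>

lemma stl_iff_unit_rel:
  assumes "d \<ge> 3" "x \<in> tail_class d \<xi>" "y \<in> tail_class d \<xi>"
  shows "stl x = stl y \<longleftrightarrow>
    (\<exists>z\<in>tail_class d \<xi>. \<not> (\<exists>r. lead d r z) \<and> unit_rel d z x \<and> unit_rel d z y)"
proof
  assume eq: "stl x = stl y"
  have "[1] @- sdrop (length [1::nat]) x \<in> tail_class d \<xi>"
    using assms(1,2) by (intro tail_class_replace) simp_all
  moreover have "1 \<noteq> d - 1" using assms(1) by linarith
  then have "\<not> lead d r ([1] @- sdrop (length [1::nat]) x)" for r
    by (cases r) simp_all
  ultimately show "\<exists>z\<in>tail_class d \<xi>. \<not> (\<exists>r. lead d r z) \<and> unit_rel d z x \<and> unit_rel d z y"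
    using eq by (intro bexI[of _ "[1] @- sdrop (length [1::nat]) x"]) (auto simp: unit_rel_def)
next
  assume "\<exists>z\<in>tail_class d \<xi>. \<not> (\<exists>r. lead d r z) \<and> unit_rel d z x \<and> unit_rel d z y"
  then obtain z where "\<not> (\<exists>r. lead d r z)" "unit_rel d z x" "unit_rel d z y" by blast
  then have "stl z = stl x" "stl z = stl y" by (auto simp: unit_rel_def spine_rel_def)
  then show "stl x = stl y" by simp
qed

lemma spine_rel_iff_unit_rel:
  "spine_rel d x y \<longleftrightarrow> x = y \<or> (unit_rel d x y \<and> stl x \<noteq> stl y)"
  using stl_spine_rel_eq[of x y d] by (auto simp: unit_rel_def spine_rel_def)

text \<open>Expressed by the existence of an exponent and by smaller exponents, since precisely
  these are known to be preserved when exponent n is treated.\<close>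

definition lead_ge :: "nat \<Rightarrow> nat \<Rightarrow> nat stream \<Rightarrow> bool" where
  "lead_ge d n \<zeta> \<longleftrightarrow> (\<exists>r. lead d r \<zeta>) \<and> (\<forall>j<n. \<not> lead d j \<zeta>)"

lemma lead_ge_iff:
  assumes "d \<ge> 2"
  shows "lead_ge d n \<zeta> \<longleftrightarrow> (\<exists>r\<ge>n. lead d r \<zeta>)"
  unfolding lead_ge_def using lead_unique[OF assms] by (metis not_less)

text \<open>The vertices with a fixed \<open>sdrop (Suc n) _ = t\<close> are joined to the others through
  \<open>(d-1)\<^sup>n 0 t\<close> and, if \<open>t\<close> begins with \<open>(d-1)\<^sup>k 0\<close> for some \<open>k\<close>, also through a vertex beginning
  with \<open>(d-1)\<^sup>k 0\<close> for some \<open>k > n\<close>. So among the remaining spine classes those with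
  \<open>r = n\<close> are the ones reaching a cluster with a single exit; this needs a letter other than
  \<open>0\<close> and \<open>d - 1\<close>.\<close>

lemma lead_iff_unique_exit:
  assumes "d \<ge> 3" "x \<in> tail_class d \<xi>"
  shows "lead d n x \<longleftrightarrow> lead_ge d n x \<and>
    (\<exists>z\<in>tail_class d \<xi>. spine_rel d x z \<and>
      (\<forall>v\<in>tail_class d \<xi>. sdrop (Suc n) v = sdrop (Suc n) z \<longrightarrow> lead_ge d n v \<longrightarrow> v = z))"
proof
  have d2: "d \<ge> 2" using assms(1) by simp
  assume L: "lead d n x"
  \<comment> \<open>The letter 1 at position n + 1 excludes larger exponents: n + 1 itself would
    need 0 there, all others d - 1.\<close>
  let ?w = "replicate n (d - 1) @ [0, 1]"
  let ?z = "?w @- sdrop (length ?w) x"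
  have z: "?z \<in> tail_class d \<xi>"
    using assms by (intro tail_class_replace) (auto simp: words_def letters_def)
  have lz: "lead d n ?z" by (auto simp: lead_def shift_snth nth_append)
  moreover have "sdrop (length ?w) ?z = sdrop (length ?w) x" by (subst sdrop_shift) simp
  then have "sdrop (Suc (Suc n)) x = sdrop (Suc (Suc n)) ?z" by simp
  ultimately have "spine_rel d x ?z" using L unfolding spine_rel_def by blast
  moreover have "v = ?z" if v: "sdrop (Suc n) v = sdrop (Suc n) ?z" "lead_ge d n v" for v
  proof -
    obtain r where r: "n \<le> r" "lead d r v" using v(2) lead_ge_iff[OF d2] by blast
    have "v !! Suc n = ?z !! Suc n" using v(1) unfolding sdrop_eq_iff_snth by blast
    also have "\<dots> = ?w ! Suc n" by (rule shift_snth_less) simp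
    also have "\<dots> = 1" by (simp add: nth_append)
    finally have v1: "v !! Suc n = 1" .
    have "r = n"
    proof (rule ccontr)
      assume "r \<noteq> n"
      then have "r = Suc n \<or> Suc n < r" using r(1) by linarith
      then show False using r(2) v1 assms(1) by (auto simp: lead_def simp del: snth.simps)
    qed
    then have "v !! i = ?z !! i" if "i \<le> n" for i
      using r(2) lz that unfolding lead_def by (metis le_neq_implies_less)
    moreover have "v !! i = ?z !! i" if "Suc n \<le> i" for i
      using v(1) that unfolding sdrop_eq_iff_snth by blast
    ultimately show ?thesis unfolding stream_eq_iff_snth by (metis not_less_eq_eq)
  qed
  moreover have "lead_ge d n x" using L lead_ge_iff[OF d2] by blast
  ultimately show "lead_ge d n x \<and>
    (\<exists>z\<in>tail_class d \<xi>. spine_rel d x z \<and>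
      (\<forall>v\<in>tail_class d \<xi>. sdrop (Suc n) v = sdrop (Suc n) z \<longrightarrow> lead_ge d n v \<longrightarrow> v = z))"
    using z by blast
next
  have d2: "d \<ge> 2" using assms(1) by simp
  assume "lead_ge d n x \<and>
    (\<exists>z\<in>tail_class d \<xi>. spine_rel d x z \<and>
      (\<forall>v\<in>tail_class d \<xi>. sdrop (Suc n) v = sdrop (Suc n) z \<longrightarrow> lead_ge d n v \<longrightarrow> v = z))"
  then obtain z where ge: "lead_ge d n x" and z: "z \<in> tail_class d \<xi>" "spine_rel d x z"
    and uniq: "\<And>v. v \<in> tail_class d \<xi> \<Longrightarrow> sdrop (Suc n) v = sdrop (Suc n) z \<Longrightarrow> lead_ge d n v \<Longrightarrow> v = z"
    by blast
  obtain r where r: "n \<le> r" "lead d r x" using ge lead_ge_iff[OF d2] by blast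
  have lz: "lead d r z" by (rule spine_rel_lead(1)[OF d2 z(2) r(2)])
  show "lead d n x"
  proof (rule ccontr)
    assume "\<not> lead d n x"
    then have n: "n < r" using r by (metis le_neq_implies_less)
    \<comment> \<open>Yields a second exit from the cluster of z: its exponent is n, whereas that of
      z is r > n.\<close>
    let ?w = "replicate n (d - 1) @ [0]"
    let ?v = "?w @- sdrop (length ?w) z"
    have "?v \<in> tail_class d \<xi>"
      using assms z(1) by (intro tail_class_replace) (auto simp: words_def letters_def)
    moreover have "sdrop (length ?w) ?v = sdrop (length ?w) z" by (subst sdrop_shift) simp
    then have "sdrop (Suc n) ?v = sdrop (Suc n) z" by simp
    moreover have lv: "lead d n ?v" by (auto simp: lead_def shift_snth nth_append)
    then have "lead_ge d n ?v" using lead_ge_iff[OF d2] by blast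
    ultimately have "?v = z" by (rule uniq)
    then have "lead d n z" using lv by simp
    then show False using lead_unique[OF d2 lz] n by blast
  qed
qed

text \<open>A cluster of level n + 2 with tail t splits into d clusters of level n + 1, and these
  are joined by the spine clique of the points (d-1)^n 0 x t.\<close>

lemma sdrop_Suc_Suc_iff:
  assumes "d \<ge> 3" "x \<in> tail_class d \<xi>" "y \<in> tail_class d \<xi>"
  shows "sdrop (Suc (Suc n)) x = sdrop (Suc (Suc n)) y \<longleftrightarrow>
    (\<exists>u\<in>tail_class d \<xi>. \<exists>v\<in>tail_class d \<xi>. sdrop (Suc n) x = sdrop (Suc n) u \<and>
      sdrop (Suc n) y = sdrop (Suc n) v \<and> spine_rel d u v \<and> lead d n u)"
proof
  assume eq: "sdrop (Suc (Suc n)) x = sdrop (Suc (Suc n)) y"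
  let ?w = "replicate n (d - 1) @ [0]"
  let ?p = "\<lambda>x. ?w @- sdrop (length ?w) x"
  have p: "?p x \<in> tail_class d \<xi>" if "x \<in> tail_class d \<xi>" for x
    using assms(1) that by (intro tail_class_replace) (auto simp: words_def letters_def)
  have "sdrop (length ?w) (?p x) = sdrop (length ?w) x" for x by (subst sdrop_shift) simp
  then have drop: "sdrop (Suc n) (?p x) = sdrop (Suc n) x" for x by simp
  have drop2: "sdrop (Suc (Suc n)) (?p x) = sdrop (Suc (Suc n)) x" for x
    using drop by (rule sdrop_eq_mono) simp
  have l: "lead d n (?p x)" for x by (auto simp: lead_def shift_snth nth_append)
  have "sdrop (Suc (Suc n)) (?p x) = sdrop (Suc (Suc n)) (?p y)"
    using eq drop2[of x] drop2[of y] by simp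
  then have "spine_rel d (?p x) (?p y)" unfolding spine_rel_def using l by blast
  then show "\<exists>u\<in>tail_class d \<xi>. \<exists>v\<in>tail_class d \<xi>. sdrop (Suc n) x = sdrop (Suc n) u \<and>
      sdrop (Suc n) y = sdrop (Suc n) v \<and> spine_rel d u v \<and> lead d n u"
    using p[OF assms(2)] p[OF assms(3)] l[of x] drop[of x, symmetric] drop[of y, symmetric] by blast
next
  assume "\<exists>u\<in>tail_class d \<xi>. \<exists>v\<in>tail_class d \<xi>. sdrop (Suc n) x = sdrop (Suc n) u \<and>
      sdrop (Suc n) y = sdrop (Suc n) v \<and> spine_rel d u v \<and> lead d n u"
  then obtain u v where uv: "sdrop (Suc n) x = sdrop (Suc n) u" "sdrop (Suc n) y = sdrop (Suc n) v"
      "spine_rel d u v" "lead d n u" by blast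
  have "sdrop (Suc (Suc n)) x = sdrop (Suc (Suc n)) u" using uv(1) by (rule sdrop_eq_mono) simp
  also have "\<dots> = sdrop (Suc (Suc n)) v" using spine_rel_lead(2)[OF _ uv(3,4)] assms(1) by simp
  also have "\<dots> = sdrop (Suc (Suc n)) y" using uv(2)[symmetric] by (rule sdrop_eq_mono) simp
  finally show "sdrop (Suc (Suc n)) x = sdrop (Suc (Suc n)) y" .
qed

text \<open>Replacing the first n letters of \<xi> by d - 1 stays in its cluster of level n and
  turns a pattern at position n into an exponent n + k, which is visible in the graph.\<close>

lemma lead_sdrop_iff:
  assumes "d \<ge> 3" "\<xi> \<in> boundary d"
  shows "lead d k (sdrop n \<xi>) \<longleftrightarrow> (\<exists>z\<in>tail_class d \<xi>. sdrop n z = sdrop n \<xi> \<and> lead d (n + k) z)"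
proof
  assume L: "lead d k (sdrop n \<xi>)"
  let ?w = "replicate n (d - 1)"
  let ?z = "?w @- sdrop (length ?w) \<xi>"
  have "\<xi> \<in> tail_class d \<xi>" using assms(2) by (auto simp: tail_class_def)
  then have "?z \<in> tail_class d \<xi>"
    using assms(1) by (intro tail_class_replace) (auto simp: words_def letters_def)
  moreover have "sdrop (length ?w) ?z = sdrop (length ?w) \<xi>" by (subst sdrop_shift) simp
  then have "sdrop n ?z = sdrop n \<xi>" by simp
  moreover have "lead d (n + k) ?z"
    using L by (auto simp: lead_def shift_snth)
  ultimately show "\<exists>z\<in>tail_class d \<xi>. sdrop n z = sdrop n \<xi> \<and> lead d (n + k) z" by blast
next
  assume "\<exists>z\<in>tail_class d \<xi>. sdrop n z = sdrop n \<xi> \<and> lead d (n + k) z"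
  then obtain z where z: "sdrop n z = sdrop n \<xi>" "lead d (n + k) z" by blast
  have "lead d k (sdrop n z)" using z(2) unfolding lead_sdrop by (simp add: lead_def)
  then show "lead d k (sdrop n \<xi>)" using z(1) by simp
qed

text \<open>Records all that is used of a graph isomorphism: the root, the existence of an exponent
  as seen from loops, and adjacency.\<close>

locale unit_rel_iso =
  fixes d :: nat and \<xi> \<eta> :: "nat stream" and \<phi> :: "nat stream \<Rightarrow> nat stream"
  assumes d: "d \<ge> 3" and bdry: "\<xi> \<in> boundary d" "\<eta> \<in> boundary d"
    and bij: "bij_betw \<phi> (tail_class d \<xi>) (tail_class d \<eta>)" and root: "\<phi> \<xi> = \<eta>"
    and lead_preserved: "\<And>x. x \<in> tail_class d \<xi> \<Longrightarrow> (\<exists>r. lead d r x) \<longleftrightarrow> (\<exists>r. lead d r (\<phi> x))"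
    and unit_rel_preserved: "\<And>x y. x \<in> tail_class d \<xi> \<Longrightarrow> y \<in> tail_class d \<xi> \<Longrightarrow>
      unit_rel d x y \<longleftrightarrow> unit_rel d (\<phi> x) (\<phi> y)"
begin

lemma bex_image: "(\<exists>z\<in>tail_class d \<eta>. P z) \<longleftrightarrow> (\<exists>z\<in>tail_class d \<xi>. P (\<phi> z))"
proof -
  have "tail_class d \<eta> = \<phi> ` tail_class d \<xi>" using bij by (simp add: bij_betw_def)
  then show ?thesis by simp
qed

lemma ball_image: "(\<forall>z\<in>tail_class d \<eta>. P z) \<longleftrightarrow> (\<forall>z\<in>tail_class d \<xi>. P (\<phi> z))"
proof -
  have "tail_class d \<eta> = \<phi> ` tail_class d \<xi>" using bij by (simp add: bij_betw_def)
  then show ?thesis by simp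
qed

lemma eq_image: "x \<in> tail_class d \<xi> \<Longrightarrow> y \<in> tail_class d \<xi> \<Longrightarrow> \<phi> x = \<phi> y \<longleftrightarrow> x = y"
  using bij unfolding bij_betw_def inj_on_def by blast

lemma image_mem: "x \<in> tail_class d \<xi> \<Longrightarrow> \<phi> x \<in> tail_class d \<eta>"
  using bij unfolding bij_betw_def by blast

lemma stl_preserved:
  assumes "x \<in> tail_class d \<xi>" "y \<in> tail_class d \<xi>"
  shows "stl (\<phi> x) = stl (\<phi> y) \<longleftrightarrow> stl x = stl y"
  unfolding stl_iff_unit_rel[OF d assms] stl_iff_unit_rel[OF d image_mem[OF assms(1)] image_mem[OF assms(2)]]
    bex_image
  using lead_preserved unit_rel_preserved assms by (intro bex_cong refl) blast

lemma spine_rel_preserved: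
  assumes "x \<in> tail_class d \<xi>" "y \<in> tail_class d \<xi>"
  shows "spine_rel d (\<phi> x) (\<phi> y) \<longleftrightarrow> spine_rel d x y"
  unfolding spine_rel_iff_unit_rel
  using stl_preserved[OF assms] unit_rel_preserved[OF assms] eq_image[OF assms] by blast

definition cluster_preserved :: "nat \<Rightarrow> bool" where
  "cluster_preserved n \<longleftrightarrow> (\<forall>x\<in>tail_class d \<xi>. \<forall>y\<in>tail_class d \<xi>.
     sdrop n (\<phi> x) = sdrop n (\<phi> y) \<longleftrightarrow> sdrop n x = sdrop n y)"

definition type_preserved :: "nat \<Rightarrow> bool" where
  "type_preserved n \<longleftrightarrow> (\<forall>x\<in>tail_class d \<xi>. lead d n (\<phi> x) \<longleftrightarrow> lead d n x)"

lemma type_step: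
  assumes "cluster_preserved (Suc n)" "\<And>j. j < n \<Longrightarrow> type_preserved j"
  shows "type_preserved n"
  unfolding type_preserved_def
proof
  fix x assume x: "x \<in> tail_class d \<xi>"
  have ge: "lead_ge d n (\<phi> y) \<longleftrightarrow> lead_ge d n y" if "y \<in> tail_class d \<xi>" for y
    using assms(2) lead_preserved[OF that] that unfolding lead_ge_def type_preserved_def by blast
  have c: "sdrop (Suc n) (\<phi> y) = sdrop (Suc n) (\<phi> z) \<longleftrightarrow> sdrop (Suc n) y = sdrop (Suc n) z"
    if "y \<in> tail_class d \<xi>" "z \<in> tail_class d \<xi>" for y z
    using assms(1) that unfolding cluster_preserved_def by blast
  show "lead d n (\<phi> x) \<longleftrightarrow> lead d n x"
    unfolding lead_iff_unique_exit[OF d x] lead_iff_unique_exit[OF d image_mem[OF x]]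
      bex_image ball_image
    using x by (simp add: ge c eq_image spine_rel_preserved del: sdrop.simps cong: bex_cong ball_cong)
qed

lemma cluster_step:
  assumes "cluster_preserved (Suc n)" "type_preserved n"
  shows "cluster_preserved (Suc (Suc n))"
  unfolding cluster_preserved_def
proof (intro ballI)
  fix x y assume x: "x \<in> tail_class d \<xi>" and y: "y \<in> tail_class d \<xi>"
  have c: "sdrop (Suc n) (\<phi> y) = sdrop (Suc n) (\<phi> z) \<longleftrightarrow> sdrop (Suc n) y = sdrop (Suc n) z"
    if "y \<in> tail_class d \<xi>" "z \<in> tail_class d \<xi>" for y z
    using assms(1) that unfolding cluster_preserved_def by blast
  have t: "lead d n (\<phi> z) \<longleftrightarrow> lead d n z" if "z \<in> tail_class d \<xi>" for z
    using assms(2) that unfolding type_preserved_def by blast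
  show "sdrop (Suc (Suc n)) (\<phi> x) = sdrop (Suc (Suc n)) (\<phi> y) \<longleftrightarrow>
      sdrop (Suc (Suc n)) x = sdrop (Suc (Suc n)) y"
    unfolding sdrop_Suc_Suc_iff[OF d x y] sdrop_Suc_Suc_iff[OF d image_mem[OF x] image_mem[OF y]]
      bex_image
    using x y by (simp add: c t spine_rel_preserved del: sdrop.simps cong: bex_cong)
qed

text \<open>Exponent n is recognized through clusters of level n + 1, and clusters of level n + 2
  through exponent n; hence the offset. The start at level 1 are the rotation cliques.\<close>

lemma all_preserved: "cluster_preserved (Suc n) \<and> (\<forall>j<n. type_preserved j)"
proof (induction n)
  case 0
  then show ?case using stl_preserved by (simp add: cluster_preserved_def)
next
  case (Suc n)
  have n: "type_preserved n"
  proof (rule type_step)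
    show "cluster_preserved (Suc n)" using Suc ..
    show "type_preserved j" if "j < n" for j using Suc that by simp
  qed
  then have "cluster_preserved (Suc (Suc n))" using Suc cluster_step by blast
  then show ?case using Suc n unfolding less_Suc_eq by blast
qed

lemma same_leads: "same_leads d \<xi> \<eta>"
  unfolding same_leads_def
proof (intro allI)
  fix n k
  have "\<xi> \<in> tail_class d \<xi>" using bdry by (auto simp: tail_class_def)
  then have c: "sdrop n (\<phi> z) = sdrop n (\<phi> \<xi>) \<longleftrightarrow> sdrop n z = sdrop n \<xi>" if "z \<in> tail_class d \<xi>" for z
  proof (cases n)
    \<comment> \<open>Level 0 is equality of points; the interleaved induction begins at level
      1.\<close>
    case 0
    then show ?thesis using eq_image[OF that \<open>\<xi> \<in> tail_class d \<xi>\<close>] by simp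
  next
    case (Suc i)
    then show ?thesis using all_preserved[of i] that \<open>\<xi> \<in> tail_class d \<xi>\<close>
      unfolding cluster_preserved_def by blast
  qed
  have t: "lead d (n + k) (\<phi> z) \<longleftrightarrow> lead d (n + k) z" if "z \<in> tail_class d \<xi>" for z
    using all_preserved[of "Suc (n + k)"] that unfolding type_preserved_def by blast
  show "lead d k (sdrop n \<xi>) \<longleftrightarrow> lead d k (sdrop n \<eta>)"
    unfolding lead_sdrop_iff[OF d bdry(1)] lead_sdrop_iff[OF d bdry(2)] bex_image
    unfolding root[symmetric] using c t by (intro bex_cong refl) blast
qed

end

section \<open>Isomorphisms of Schreier graphs\<close>

text \<open>Separates the arguments about multigraphs from spinal groups; Schreier graphs are
  instances.\<close>

definition action_graph :: "'v set \<Rightarrow> 's set \<Rightarrow> ('s \<Rightarrow> 'v \<Rightarrow> 'v) \<Rightarrow> ('v, 'v \<times> 's) pre_digraph" where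
  "action_graph V S act = \<lparr>verts = V, arcs = V \<times> S, tail = (\<lambda>(y, s). y), head = (\<lambda>(y, s). act s y)\<rparr>"

text \<open>Equal counts for each ordered pair of vertices give bijections of labels pair by pair;
  joined together they form an edge bijection that even keeps directions.\<close>

lemma rooted_undirected_iso_if_card:
  assumes fin: "finite S" and bij: "bij_betw \<phi> V W" and "\<phi> x = y"
    and V: "\<And>v s. v \<in> V \<Longrightarrow> s \<in> S \<Longrightarrow> act s v \<in> V" and W: "\<And>w s. w \<in> W \<Longrightarrow> s \<in> S \<Longrightarrow> act s w \<in> W"
    and card: "\<And>v v'. v \<in> V \<Longrightarrow> v' \<in> V \<Longrightarrow>
      card {s \<in> S. act s v = v'} = card {s \<in> S. act s (\<phi> v) = \<phi> v'}"
  shows "rooted_undirected_iso (action_graph V S act) x (action_graph W S act) y"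
proof -
  have "\<exists>f. bij_betw f {s \<in> S. act s v = v'} {s \<in> S. act s (\<phi> v) = \<phi> v'}" if "v \<in> V" "v' \<in> V" for v v'
    using fin card[OF that] by (intro finite_same_card_bij) simp_all
  then obtain f where f: "\<And>v v'. v \<in> V \<Longrightarrow> v' \<in> V \<Longrightarrow>
      bij_betw (f v v') {s \<in> S. act s v = v'} {s \<in> S. act s (\<phi> v) = \<phi> v'}"
    by metis
  \<comment> \<open>Each label at v is sent by the bijection for the pair of endpoints of its
    edge.\<close>
  define g where "g v s = f v (act s v) s" for v s
  have g: "g v s \<in> S" "act (g v s) (\<phi> v) = \<phi> (act s v)" if "v \<in> V" "s \<in> S" for v s
    using bij_betwE[OF f[OF that(1) V[OF that]]] that by (auto simp: g_def)
  have inj: "inj_on \<phi> V" and im: "\<phi> ` V = W" using bij by (simp_all add: bij_betw_def)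
  have g_inj: "s = t" if "v \<in> V" "s \<in> S" "t \<in> S" "g v s = g v t" for v s t
  proof -
    have "\<phi> (act s v) = \<phi> (act t v)" using g(2) that by metis
    then have "act s v = act t v" using inj V that by (meson inj_onD)
    then show ?thesis using f[OF that(1) V[OF that(1,2)]] that
      unfolding g_def bij_betw_def inj_on_def by auto
  qed
  have g_surj: "\<exists>s\<in>S. g v s = t" if "v \<in> V" "t \<in> S" for v t
  proof -
    have "act t (\<phi> v) \<in> W" using W that im by blast
    then obtain v' where v': "v' \<in> V" "act t (\<phi> v) = \<phi> v'" using im by auto
    then have "t \<in> f v v' ` {s \<in> S. act s v = v'}"
      using f[OF that(1) v'(1)] that unfolding bij_betw_def by blast
    then show ?thesis unfolding g_def by blast
  qed
  let ?\<psi> = "\<lambda>(v, s). (\<phi> v, g v s)"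
  have "bij_betw ?\<psi> (V \<times> S) (W \<times> S)"
  proof (rule bij_betwI')
    fix e e' assume "e \<in> V \<times> S" "e' \<in> V \<times> S"
    then show "?\<psi> e = ?\<psi> e' \<longleftrightarrow> e = e'" using inj g_inj by (auto dest: inj_onD)
  next
    fix e assume "e \<in> V \<times> S"
    then show "?\<psi> e \<in> W \<times> S" using g(1) im by auto
  next
    fix e assume "e \<in> W \<times> S"
    then obtain v t where "e = (\<phi> v, t)" "v \<in> V" "t \<in> S" using im by auto
    then show "\<exists>x\<in>V \<times> S. e = ?\<psi> x" using g_surj[of v t] by auto
  qed
  moreover have "{\<phi> v, act (g v s) (\<phi> v)} = \<phi> ` {v, act s v}" if "v \<in> V" "s \<in> S" for v s
    using g(2)[OF that] by simp
  ultimately show ?thesis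
    unfolding rooted_undirected_iso_def action_graph_def using bij assms(3)
    by (intro exI[of _ \<phi>] exI[of _ ?\<psi>]) auto
qed

text \<open>The edge bijection may reverse edges, so only information insensitive to this is
  extracted: loop counts and adjacency in either direction.\<close>

lemma rooted_undirected_iso_cases:
  assumes iso: "rooted_undirected_iso (action_graph V S act) x (action_graph W S act) y"
    and V: "\<And>v s. v \<in> V \<Longrightarrow> s \<in> S \<Longrightarrow> act s v \<in> V"
  obtains \<phi> where "bij_betw \<phi> V W" "\<phi> x = y"
    "\<And>v. v \<in> V \<Longrightarrow> card {s \<in> S. act s v = v} = card {s \<in> S. act s (\<phi> v) = \<phi> v}"
    "\<And>v v'. v \<in> V \<Longrightarrow> v' \<in> V \<Longrightarrow>
      (\<exists>s\<in>S. act s v = v' \<or> act s v' = v) \<longleftrightarrow> (\<exists>s\<in>S. act s (\<phi> v) = \<phi> v' \<or> act s (\<phi> v') = \<phi> v)"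
proof -
  obtain \<phi> \<psi> where bij: "bij_betw \<phi> V W" and bij': "bij_betw \<psi> (V \<times> S) (W \<times> S)" and root: "\<phi> x = y"
    and ends: "\<And>v s. v \<in> V \<Longrightarrow> s \<in> S \<Longrightarrow>
      {fst (\<psi> (v, s)), act (snd (\<psi> (v, s))) (fst (\<psi> (v, s)))} = \<phi> ` {v, act s v}"
  proof -
    from iso obtain \<phi> \<psi> where "bij_betw \<phi> V W" "bij_betw \<psi> (V \<times> S) (W \<times> S)" "\<phi> x = y"
      and ends: "\<forall>e\<in>V \<times> S. {case \<psi> e of (v, s) \<Rightarrow> v, case \<psi> e of (v, s) \<Rightarrow> act s v} =
        \<phi> ` {case e of (v, s) \<Rightarrow> v, case e of (v, s) \<Rightarrow> act s v}"
      unfolding rooted_undirected_iso_def action_graph_def pre_digraph.simps by blast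
    then show thesis using that[of \<phi> \<psi>] by (simp add: case_prod_beta)
  qed
  have inj: "inj_on \<phi> V" and im: "\<phi> ` V = W" using bij by (simp_all add: bij_betw_def)
  have inj': "inj_on \<psi> (V \<times> S)" and im': "\<psi> ` (V \<times> S) = W \<times> S" using bij' by (simp_all add: bij_betw_def)
  have ends_iff: "{fst (\<psi> e), act (snd (\<psi> e)) (fst (\<psi> e))} = {\<phi> v, \<phi> v'} \<longleftrightarrow> {fst e, act (snd e) (fst e)} = {v, v'}"
    if "v \<in> V" "v' \<in> V" "e \<in> V \<times> S" for v v' e
  proof -
    have e: "fst e \<in> V" "snd e \<in> S" "act (snd e) (fst e) \<in> V" using that(3) V by auto
    have "{fst (\<psi> e), act (snd (\<psi> e)) (fst (\<psi> e))} = \<phi> ` {fst e, act (snd e) (fst e)}"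
      using ends[OF e(1,2)] by simp
    moreover have "\<phi> ` {fst e, act (snd e) (fst e)} = \<phi> ` {v, v'} \<longleftrightarrow> {fst e, act (snd e) (fst e)} = {v, v'}"
      by (rule inj_on_image_eq_iff[OF inj]) (use e that in auto)
    ultimately show ?thesis by simp
  qed
  \<comment> \<open>Edges by unordered pair of endpoints; \<psi> carries these sets onto each
    other.\<close>
  let ?E = "\<lambda>U v v'. {e \<in> U \<times> S. {fst e, act (snd e) (fst e)} = {v, v'}}"
  have E: "?E W (\<phi> v) (\<phi> v') = \<psi> ` ?E V v v'" if "v \<in> V" "v' \<in> V" for v v'
    unfolding im'[symmetric] Compr_image_eq using ends_iff[OF that]
    by (intro arg_cong[where f = "image \<psi>"] Collect_cong) blast
  show thesis
  proof (rule that[OF bij root])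
    fix v assume v: "v \<in> V"
    have loops: "card (?E U u u) = card {s \<in> S. act s u = u}" if "u \<in> U" for U u
    proof -
      have "?E U u u = Pair u ` {s \<in> S. act s u = u}" using that by auto
      then show ?thesis by (simp add: card_image inj_on_def)
    qed
    have "card (?E W (\<phi> v) (\<phi> v)) = card (?E V v v)"
      unfolding E[OF v v] using inj' by (intro card_image inj_on_subset[OF inj']) auto
    then show "card {s \<in> S. act s v = v} = card {s \<in> S. act s (\<phi> v) = \<phi> v}"
      using loops[OF v] loops[of "\<phi> v" W] v im by auto
  next
    fix v v' assume v: "v \<in> V" "v' \<in> V"
    have adj: "?E U u u' \<noteq> {} \<longleftrightarrow> (\<exists>s\<in>S. act s u = u' \<or> act s u' = u)" if "u \<in> U" "u' \<in> U" for U u u'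
    proof
      assume "?E U u u' \<noteq> {}"
      then obtain a s where "s \<in> S" "{a, act s a} = {u, u'}" by auto
      then show "\<exists>s\<in>S. act s u = u' \<or> act s u' = u" by (auto simp: doubleton_eq_iff)
    next
      assume "\<exists>s\<in>S. act s u = u' \<or> act s u' = u"
      then obtain s where "s \<in> S" "act s u = u' \<or> act s u' = u" by blast
      then have "(u, s) \<in> ?E U u u' \<or> (u', s) \<in> ?E U u u'" using that by auto
      then show "?E U u u' \<noteq> {}" by blast
    qed
    have "?E V v v' \<noteq> {} \<longleftrightarrow> ?E W (\<phi> v) (\<phi> v') \<noteq> {}" unfolding E[OF v] by blast
    then show "(\<exists>s\<in>S. act s v = v' \<or> act s v' = v) \<longleftrightarrow>
        (\<exists>s\<in>S. act s (\<phi> v) = \<phi> v' \<or> act s (\<phi> v') = \<phi> v)"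
      using adj[OF v] adj[of "\<phi> v" W "\<phi> v'"] v im by auto
  qed
qed

context spinal begin

lemma schreier_graph_eq:
  "\<xi> \<in> boundary d \<Longrightarrow> schreier_graph d m \<omega> \<xi> = action_graph (tail_class d \<xi>) S bdry_act"
  by (simp add: schreier_graph_def action_graph_def orbit_eq)

lemma act_closed:
  assumes "\<xi> \<in> boundary d" "y \<in> tail_class d \<xi>" "s \<in> S"
  shows "bdry_act s y \<in> tail_class d \<xi>"
  using orbit_generator[of \<xi> y s] assms by (simp add: orbit_eq spinal_gens_def)

lemma iso_if_same_leads:
  assumes bdry: "\<xi> \<in> boundary d" "\<eta> \<in> boundary d" and same: "same_leads d \<xi> \<eta>"
  shows "rooted_undirected_iso (schreier_graph d m \<omega> \<xi>) \<xi> (schreier_graph d m \<omega> \<eta>) \<eta>"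
  unfolding schreier_graph_eq[OF bdry(1)] schreier_graph_eq[OF bdry(2)]
proof (rule rooted_undirected_iso_if_card[OF finite_S, where \<phi> = "swap_tail \<xi> \<eta>"])
  \<comment> \<open>The facts on \<open>swap_tail\<close> are implications; their converses come
    from applying them to its inverse, in which \<xi> and \<eta> trade places.\<close>
  note same' = same_leads_sym[OF same]
  note inv = swap_tail_inverse[of _ d \<xi> \<eta>] swap_tail_inverse[of _ d \<eta> \<xi>]
  note mem = swap_tail_in_tail_class[OF bdry] swap_tail_in_tail_class[OF bdry(2,1)]
  show "bij_betw (swap_tail \<xi> \<eta>) (tail_class d \<xi>) (tail_class d \<eta>)"
    by (rule bij_betw_byWitness[where f' = "swap_tail \<eta> \<xi>"]) (use inv mem in auto)
  fix y z assume y: "y \<in> tail_class d \<xi>" and z: "z \<in> tail_class d \<xi>"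
  let ?\<phi> = "swap_tail \<xi> \<eta>"
  have "card (fibre y z) = card (fibre (?\<phi> y) (?\<phi> z))"
  proof (rule card_fibre_eq)
    show "y \<in> boundary d" "?\<phi> y \<in> boundary d" "z \<in> boundary d" "?\<phi> z \<in> boundary d"
      using y z mem(1)[OF y] mem(1)[OF z] by (simp_all add: tail_class_def)
    show "y = z \<longleftrightarrow> ?\<phi> y = ?\<phi> z" using inv(1)[OF y] inv(1)[OF z] by metis
    show "stl y = stl z \<longleftrightarrow> stl (?\<phi> y) = stl (?\<phi> z)"
      using stl_swap_tail[of y z \<xi> \<eta>] stl_swap_tail[of "?\<phi> y" "?\<phi> z" \<eta> \<xi>] inv(1)[OF y] inv(1)[OF z] by auto
    show "spine_rel d y z \<longleftrightarrow> spine_rel d (?\<phi> y) (?\<phi> z)"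
      using spine_rel_swap_tail[OF same, of y z] spine_rel_swap_tail[OF same', of "?\<phi> y" "?\<phi> z"]
        inv(1)[OF y] inv(1)[OF z] by auto
    show "lead d r y \<longleftrightarrow> lead d r (?\<phi> y)" for r
      using lead_swap_tail[OF same, of r y] lead_swap_tail[OF same', of r "?\<phi> y"] inv(1)[OF y] by auto
  qed
  then show "card {s \<in> S. bdry_act s y = z} = card {s \<in> S. bdry_act s (?\<phi> y) = ?\<phi> z}"
    unfolding fibre_def .
qed (use act_closed bdry swap_tail_root in auto)

lemma same_leads_if_iso:
  assumes bdry: "\<xi> \<in> boundary d" "\<eta> \<in> boundary d"
    and iso: "rooted_undirected_iso (schreier_graph d m \<omega> \<xi>) \<xi> (schreier_graph d m \<omega> \<eta>) \<eta>"
  shows "same_leads d \<xi> \<eta>"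
proof -
  obtain \<phi> where bij: "bij_betw \<phi> (tail_class d \<xi>) (tail_class d \<eta>)" and root: "\<phi> \<xi> = \<eta>"
    and loops: "\<And>v. v \<in> tail_class d \<xi> \<Longrightarrow>
      card {s \<in> S. bdry_act s v = v} = card {s \<in> S. bdry_act s (\<phi> v) = \<phi> v}"
    and adj: "\<And>v v'. v \<in> tail_class d \<xi> \<Longrightarrow> v' \<in> tail_class d \<xi> \<Longrightarrow>
      (\<exists>s\<in>S. bdry_act s v = v' \<or> bdry_act s v' = v) \<longleftrightarrow>
      (\<exists>s\<in>S. bdry_act s (\<phi> v) = \<phi> v' \<or> bdry_act s (\<phi> v') = \<phi> v)"
    using rooted_undirected_iso_cases[OF iso[unfolded schreier_graph_eq[OF bdry(1)] schreier_graph_eq[OF bdry(2)]]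
        act_closed[OF bdry(1)]] by blast
  have b: "v \<in> boundary d" "\<phi> v \<in> boundary d" if "v \<in> tail_class d \<xi>" for v
    using that bij_betwE[OF bij] by (auto simp: tail_class_def)
  \<comment> \<open>Distinct points only, as \<open>unit_rel\<close> is reflexive whether or not
    there is a loop.\<close>
  have adj_iff: "(\<exists>s\<in>S. bdry_act s v = v' \<or> bdry_act s v' = v) \<longleftrightarrow> unit_rel d v v'"
    if "v \<in> boundary d" "v' \<in> boundary d" "v \<noteq> v'" for v v'
  proof -
    have "(\<exists>s\<in>S. bdry_act s v = v' \<or> bdry_act s v' = v) \<longleftrightarrow> fibre v v' \<noteq> {} \<or> fibre v' v \<noteq> {}"
      by (auto simp: fibre_def)
    then show ?thesis
      using fibre_nonempty_iff[OF that] fibre_nonempty_iff[OF that(2,1)] that(3) spine_rel_sym[of d v v']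
      by (auto simp: unit_rel_def)
  qed
  interpret unit_rel_iso d \<xi> \<eta> \<phi>
  proof
    fix x assume x: "x \<in> tail_class d \<xi>"
    show "(\<exists>r. lead d r x) \<longleftrightarrow> (\<exists>r. lead d r (\<phi> x))"
      unfolding lead_iff_card_fibre[OF b(1)[OF x]] lead_iff_card_fibre[OF b(2)[OF x]]
      unfolding fibre_def loops[OF x] ..
  next
    fix x y assume x: "x \<in> tail_class d \<xi>" and y: "y \<in> tail_class d \<xi>"
    show "unit_rel d x y \<longleftrightarrow> unit_rel d (\<phi> x) (\<phi> y)"
    proof (cases "x = y")
      case True
      then show ?thesis by (simp add: unit_rel_def)
    next
      case False
      then have "\<phi> x \<noteq> \<phi> y" using bij x y unfolding bij_betw_def inj_on_def by blast
      then show ?thesis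
        using adj[OF x y] adj_iff[OF b(1)[OF x] b(1)[OF y] False] adj_iff[OF b(2)[OF x] b(2)[OF y]] by simp
    qed
  qed (use d bdry bij root in auto)
  show ?thesis by (rule same_leads)
qed

end

theorem theorem7p10:
  fixes d m :: nat and \<omega> :: spinal_seq and \<xi> \<eta> :: "nat stream"
  assumes "d \<ge> 3" and "m \<ge> 1" and "\<omega> \<in> Omega d m"
    and "\<xi> \<in> boundary d" and "\<eta> \<in> boundary d"
  shows "rooted_undirected_iso (schreier_graph d m \<omega> \<xi>) \<xi> (schreier_graph d m \<omega> \<eta>) \<eta>
    \<longleftrightarrow> compatible d \<xi> \<eta>"
proof -
  interpret spinal d m \<omega> by standard (rule assms)+
  have "d \<ge> 2" using assms(1) by simp
  show ?thesis
  proof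
    assume "rooted_undirected_iso (schreier_graph d m \<omega> \<xi>) \<xi> (schreier_graph d m \<omega> \<eta>) \<eta>"
    then have "same_leads d \<xi> \<eta>" by (rule same_leads_if_iso[OF assms(4,5)])
    then show "compatible d \<xi> \<eta>" by (rule compatible_if_same_leads[OF \<open>d \<ge> 2\<close> assms(4,5)])
  next
    assume "compatible d \<xi> \<eta>"
    then have "same_leads d \<xi> \<eta>" by (rule same_leads_if_compatible[OF \<open>d \<ge> 2\<close>])
    then show "rooted_undirected_iso (schreier_graph d m \<omega> \<xi>) \<xi> (schreier_graph d m \<omega> \<eta>) \<eta>"
      by (rule iso_if_same_leads[OF assms(4,5)])
  qed
qed

end
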